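(* There exists an algorithm that, given probe access to an Ising model with Gibbs distribution $\mu$ on a graph $G=(V,E)$ with maximum degree $\Delta\ge1$, arbitrary external fields $\lambda_v$ at each $v\in V$, and edge activity $\beta$ satisfying $$\beta\in\left(\frac{\Delta-0.5}{\Delta},\frac{\Delta}{\Delta-0.5}\right),$$ and given a subset of vertices $\Lambda\subseteq V$, outputs a perfect sample $X\sim\mu_\Lambda$ (that is, $X$ is distributed exactly according to $\mu_\Lambda$) in expected time $O(\Delta\cdot|\Lambda|)$.
   Context: The Ising model with edge activity $\beta>0$ and external fields $\lambda_v\in\mathbb R_{\ge0}^2$ on a finite graph $G=(V,E)$ is the $2$-spin system with interaction matrix $A_e=\begin{pmatrix}\beta&1\\1&\beta\end{pmatrix}$ at each edge $e\in E$. Its Gibbs distribution on $\{1,2\}^V$ is $\mu(\sigma)=w(\sigma)/Z$, where $w(\sigma)=\prod_{v\in V}\lambda_v(\sigma(v))\prod_{e=(u,v)\in E}A_e(\sigma(u),\sigma(v))$ and $Z=\sum_\sigma w(\sigma)$. For $\Lambda\subseteq V$, the marginal distribution is $\mu_\Lambda(\tau)=\sum_{\sigma\in\{1,2\}^V:\sigma_\Lambda=\tau}\mu(\sigma)$ for $\tau\in\{1,2\}^\Lambda$. Probe access means: for each $v\in V$, each neighbor of $v$ can be accessed in $O(1)$ time, and each entry of every $\lambda_v$ and $A_e$ can be retrieved in $O(1)$ time. *)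

theory Defs
  imports "HOL-Probability.Probability"
begin

section \<open>2-spin systems and the Ising model\<close>

text \<open>
  A 2-spin system on a finite simple graph whose vertices are named 0, ..., \<open>num_verts - 1\<close>.
  Spins are 1 and 2; an edge is a two-element set of vertices.
\<close>

record spin_system =
  num_verts :: nat
  edges :: "nat set set"
  ext_field :: "nat \<Rightarrow> nat \<Rightarrow> real"
  interaction :: "nat set \<Rightarrow> nat \<Rightarrow> nat \<Rightarrow> real"

definition verts :: "spin_system \<Rightarrow> nat set" where
  "verts M = {..<num_verts M}"

definition simple_graph :: "spin_system \<Rightarrow> bool" where
  "simple_graph M \<longleftrightarrow> (\<forall>e\<in>edges M. \<exists>u\<in>verts M. \<exists>v\<in>verts M. u \<noteq> v \<and> e = {u, v})"

definition vertex_degree :: "spin_system \<Rightarrow> nat \<Rightarrow> nat" where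
  "vertex_degree M v = card {e \<in> edges M. v \<in> e}"

text \<open>The inserted 0 only matters for the graph without vertices.\<close>

definition max_degree :: "spin_system \<Rightarrow> nat" where
  "max_degree M = Max (insert 0 (vertex_degree M ` verts M))"

definition configs :: "nat set \<Rightarrow> (nat \<Rightarrow> nat) set" where
  "configs S = (S \<rightarrow>\<^sub>E {1, 2})"

text \<open>
  The edge factor is read with the smaller endpoint first. The interaction matrix of an
  Ising model is symmetric, so the orientation is immaterial there.
\<close>

definition weight :: "spin_system \<Rightarrow> (nat \<Rightarrow> nat) \<Rightarrow> real" where
  "weight M \<sigma> = (\<Prod>v\<in>verts M. ext_field M v (\<sigma> v)) *
                (\<Prod>e\<in>edges M. interaction M e (\<sigma> (Min e)) (\<sigma> (Max e)))"

definition partition_function :: "spin_system \<Rightarrow> real" where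
  "partition_function M = (\<Sum>\<sigma>\<in>configs (verts M). weight M \<sigma>)"

definition gibbs :: "spin_system \<Rightarrow> (nat \<Rightarrow> nat) \<Rightarrow> real" where
  "gibbs M \<sigma> = weight M \<sigma> / partition_function M"

definition marginal :: "spin_system \<Rightarrow> nat set \<Rightarrow> (nat \<Rightarrow> nat) \<Rightarrow> real" where
  "marginal M \<Lambda> \<tau> = (\<Sum>\<sigma> | \<sigma> \<in> configs (verts M) \<and> restrict \<sigma> \<Lambda> = \<tau>. gibbs M \<sigma>)"

definition ising_matrix :: "real \<Rightarrow> nat \<Rightarrow> nat \<Rightarrow> real" where
  "ising_matrix \<beta> a b = (if a = b then \<beta> else 1)"

text \<open>
  Positivity of the partition function is what makes the Gibbs distribution well defined;
  for positive activity it says that no external field vanishes identically.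
\<close>

definition ising_model :: "spin_system \<Rightarrow> real \<Rightarrow> bool" where
  "ising_model M \<beta> \<longleftrightarrow>
     simple_graph M \<and>
     0 < \<beta> \<and>
     (\<forall>e\<in>edges M. \<forall>a\<in>{1, 2}. \<forall>b\<in>{1, 2}. interaction M e a b = ising_matrix \<beta> a b) \<and>
     (\<forall>v\<in>verts M. \<forall>c\<in>{1, 2}. 0 \<le> ext_field M v c) \<and>
     0 < partition_function M"

definition adjacency_lists :: "spin_system \<Rightarrow> (nat \<Rightarrow> nat list) \<Rightarrow> bool" where
  "adjacency_lists M adj \<longleftrightarrow>
     (\<forall>v\<in>verts M. distinct (adj v) \<and> set (adj v) = {u. {u, v} \<in> edges M})"


section \<open>Randomized algorithms with probe access\<close>

text \<open>
  Programs run on a randomized real RAM: finitely many arrays of natural numbers (for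
  addresses, counters and spins) and finitely many arrays of reals, indexed by run-time
  addresses and initially zero. Natural numbers are only added, subtracted (with
  truncation) and compared; reals admit the field operations and comparison, but
  no rounding to integers. Constants in programs are natural or rational numbers. The
  sole source of randomness is a coin whose bias is a computed real.

  The input is visible only through the number of vertices (\<open>NumVerts\<close>), the list of query
  vertices (\<open>QuerySize\<close>, \<open>QueryAt\<close>), and the probes \<open>Nbr\<close> (the i-th neighbour of v),
  \<open>FieldAt\<close> (an entry of the field at v) and \<open>InteractionAt\<close> (an entry of the matrix
  at the edge between u and v). Neither the maximum degree nor the degrees nor the activity
  is given directly. Out-of-range positions in a list yield \<open>NumVerts\<close>, which names no vertex.
\<close>

datatype nexp =
    NConst nat
  | NLoad nat nexp
  | NAdd nexp nexp
  | NSub nexp nexp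
  | NumVerts
  | QuerySize
  | QueryAt nexp
  | Nbr nexp nexp

datatype rexp =
    RConst rat
  | RLoad nat nexp
  | RAdd rexp rexp
  | RSub rexp rexp
  | RMul rexp rexp
  | RDiv rexp rexp
  | FieldAt nexp nexp
  | InteractionAt nexp nexp nexp nexp

datatype bexp =
    NLess nexp nexp
  | RLess rexp rexp
  | BNot bexp
  | BAnd bexp bexp

datatype com =
    Skip
  | NStore nat nexp nexp
  | RStore nat nexp rexp
  | Flip nat nexp rexp
  | Seq com com
  | Cond bexp com com
  | While bexp com

record input =
  model :: spin_system
  nbrs :: "nat \<Rightarrow> nat list"
  queries :: "nat list"

record store =
  nmem :: "nat \<Rightarrow> nat \<Rightarrow> nat"
  rmem :: "nat \<Rightarrow> nat \<Rightarrow> real"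

definition init_store :: store where
  "init_store = \<lparr>nmem = (\<lambda>_ _. 0), rmem = (\<lambda>_ _. 0)\<rparr>"

definition nupdate :: "nat \<Rightarrow> nat \<Rightarrow> nat \<Rightarrow> store \<Rightarrow> store" where
  "nupdate a i x s = s\<lparr>nmem := (nmem s)(a := (nmem s a)(i := x))\<rparr>"

definition rupdate :: "nat \<Rightarrow> nat \<Rightarrow> real \<Rightarrow> store \<Rightarrow> store" where
  "rupdate a i x s = s\<lparr>rmem := (rmem s)(a := (rmem s a)(i := x))\<rparr>"

fun nval :: "input \<Rightarrow> store \<Rightarrow> nexp \<Rightarrow> nat" where
  "nval I s (NConst k) = k"
| "nval I s (NLoad a i) = nmem s a (nval I s i)"
| "nval I s (NAdd x y) = nval I s x + nval I s y"
| "nval I s (NSub x y) = nval I s x - nval I s y"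
| "nval I s NumVerts = num_verts (model I)"
| "nval I s QuerySize = length (queries I)"
| "nval I s (QueryAt i) =
     (let k = nval I s i
      in if k < length (queries I) then queries I ! k else num_verts (model I))"
| "nval I s (Nbr v i) =
     (let l = nbrs I (nval I s v); k = nval I s i
      in if k < length l then l ! k else num_verts (model I))"

fun rval :: "input \<Rightarrow> store \<Rightarrow> rexp \<Rightarrow> real" where
  "rval I s (RConst q) = of_rat q"
| "rval I s (RLoad a i) = rmem s a (nval I s i)"
| "rval I s (RAdd x y) = rval I s x + rval I s y"
| "rval I s (RSub x y) = rval I s x - rval I s y"
| "rval I s (RMul x y) = rval I s x * rval I s y"
| "rval I s (RDiv x y) = rval I s x / rval I s y"
| "rval I s (FieldAt v c) = ext_field (model I) (nval I s v) (nval I s c)"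
| "rval I s (InteractionAt u v a b) =
     interaction (model I) {nval I s u, nval I s v} (nval I s a) (nval I s b)"

fun bval :: "input \<Rightarrow> store \<Rightarrow> bexp \<Rightarrow> bool" where
  "bval I s (NLess x y) \<longleftrightarrow> nval I s x < nval I s y"
| "bval I s (RLess x y) \<longleftrightarrow> rval I s x < rval I s y"
| "bval I s (BNot b) \<longleftrightarrow> \<not> bval I s b"
| "bval I s (BAnd b c) \<longleftrightarrow> bval I s b \<and> bval I s c"

text \<open>
  The result is the sub-distribution of the final store together with the running time;
  the missing mass is the probability of divergence. Every elementary command and every
  evaluation of a guard takes one time unit: a program is a fixed finite text, so its
  expressions are of bounded size, and charging each arithmetic operation, memory access
  and probe in them separately would change running times by a constant factor only.
  The bias of a coin is clamped to the unit interval.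
\<close>

partial_function (spmf) exec :: "input \<Rightarrow> com \<Rightarrow> store \<Rightarrow> (store \<times> nat) spmf" where
  "exec I c s = (case c of
      Skip \<Rightarrow> return_spmf (s, 1)
    | NStore a i x \<Rightarrow> return_spmf (nupdate a (nval I s i) (nval I s x) s, 1)
    | RStore a i x \<Rightarrow> return_spmf (rupdate a (nval I s i) (rval I s x) s, 1)
    | Flip a i p \<Rightarrow> bind_spmf (spmf_of_pmf (bernoulli_pmf (rval I s p))) (\<lambda>b.
        return_spmf (nupdate a (nval I s i) (if b then 1 else 0) s, 1))
    | Seq c1 c2 \<Rightarrow> bind_spmf (exec I c1 s) (\<lambda>(s1, t1).
        bind_spmf (exec I c2 s1) (\<lambda>(s2, t2). return_spmf (s2, t1 + t2)))
    | Cond b c1 c2 \<Rightarrow> bind_spmf (exec I (if bval I s b then c1 else c2) s) (\<lambda>(s1, t1).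
        return_spmf (s1, 1 + t1))
    | While b c1 \<Rightarrow>
        if bval I s b then
          bind_spmf (exec I c1 s) (\<lambda>(s1, t1).
            bind_spmf (exec I (While b c1) s1) (\<lambda>(s2, t2). return_spmf (s2, 1 + t1 + t2)))
        else return_spmf (s, 1))"

definition run :: "com \<Rightarrow> input \<Rightarrow> (store \<times> nat) spmf" where
  "run P I = exec I P init_store"

text \<open>
  The output is a spin for each query vertex; it is read off array 0, the spin of v being
  found at index v.
\<close>

definition sampled_config :: "com \<Rightarrow> input \<Rightarrow> (nat \<Rightarrow> nat) spmf" where
  "sampled_config P I = map_spmf (\<lambda>(s, t). restrict (nmem s 0) (set (queries I))) (run P I)"

text \<open>This is the expected running time of programs that terminate almost surely.\<close>

definition expected_time :: "com \<Rightarrow> input \<Rightarrow> ennreal" where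
  "expected_time P I = (\<integral>\<^sup>+ (s, t). of_nat t \<partial>measure_spmf (run P I))"

end

theory Submission
  imports Defs
begin

text \<open>
  To sample the spin of a vertex \<open>v\<close> given pinned spins, delete all edges at \<open>v\<close>, draw a colour
  \<open>c\<close> from the field at \<open>v\<close>, and put the edges back one at a time. An edge factor, divided by
  \<open>max 1 \<beta>\<close>, is 1 or \<open>q = min \<beta> (1 / \<beta>)\<close>. So the edge to \<open>u\<close> passes with probability \<open>q\<close>
  without looking at \<open>u\<close>; otherwise the spin of \<open>u\<close> is sampled recursively in the current graph,
  where \<open>v\<close> is pinned to \<open>c\<close>, and the edge passes iff its factor is 1. If an edge fails, the update of
  \<open>v\<close> restarts. Putting back an edge multiplies the partition function by the probability
  that it passes, so the acceptance probabilities telescope and \<open>v\<close> gets its exact conditional law.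

  A call made from a neighbour of \<open>v\<close> finds at most \<open>\<Delta> - 1\<close> edges at \<open>v\<close>, so with
  \<open>q > 1 - 1 / (2 * \<Delta>)\<close> it makes fewer than \<open>q powr (1 - \<Delta>) - 1 < 2 / 3\<close> calls on average: the
  recursion is a uniformly subcritical branching process.

  The recursion runs as a stack machine in a single loop. Its conditional output
  probability is preserved by every step, which bounds each output probability from above; an
  expected cost that drops by one in every step gives termination and the running time. Since
  the upper bounds sum to one, they are equalities.
\<close>

section \<open>Expectations of randomized programs\<close>

lemma nn_integral_bind_spmf:
  "(\<integral>\<^sup>+ x. f x \<partial>measure_spmf (bind_spmf p g)) = (\<integral>\<^sup>+ y. \<integral>\<^sup>+ x. f x \<partial>measure_spmf (g y) \<partial>measure_spmf p)"
  unfolding measure_spmf_bind o_def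
  by (rule nn_integral_bind[where B="count_space UNIV"])
    (auto simp: space_measure_spmf space_subprob_algebra)

lemma nn_integral_ord_spmf_mono:
  "ord_spmf (=) p q \<Longrightarrow> (\<integral>\<^sup>+ x. f x \<partial>measure_spmf p) \<le> (\<integral>\<^sup>+ x. f x \<partial>measure_spmf q)"
  by (auto simp: nn_integral_measure_spmf intro!: nn_integral_mono mult_right_mono dest: ord_spmf_eq_leD)

text \<open>Monotone convergence along a chain that need not be countable: the limit has countable
  support, and over a countable base the supremum of a chain of functions can be pulled out of the
  integral.\<close>

lemma nn_integral_lub_spmf:
  assumes chain: "Complete_Partial_Order.chain (ord_spmf (=)) Y" and Y: "Y \<noteq> {}"
  shows "(\<integral>\<^sup>+ x. f x \<partial>measure_spmf (lub_spmf Y)) = (SUP p\<in>Y. \<integral>\<^sup>+ x. f x \<partial>measure_spmf p)"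
proof -
  let ?M = "count_space (set_spmf (lub_spmf Y))"
  have "(\<integral>\<^sup>+ x. f x \<partial>measure_spmf (lub_spmf Y)) = (\<integral>\<^sup>+ x. ennreal (spmf (lub_spmf Y) x) * f x \<partial>?M)"
    by (simp add: nn_integral_measure_spmf')
  also have "\<dots> = (\<integral>\<^sup>+ x. (SUP p\<in>Y. ennreal (spmf p x) * f x) \<partial>?M)"
    by (simp add: ennreal_spmf_lub_spmf[OF chain Y] SUP_mult_right_ennreal Y)
  also from Y have "\<dots> = (SUP p\<in>Y. \<integral>\<^sup>+ x. ennreal (spmf p x) * f x \<partial>?M)"
  proof (rule nn_integral_monotone_convergence_SUP_countable)
    have "(\<lambda>p x. ennreal (spmf p x) * f x) ` Y = (\<lambda>g x. g x * f x) ` (\<lambda>p x. ennreal (spmf p x)) ` Y"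
      by (simp add: image_image)
    also have "Complete_Partial_Order.chain (\<le>) \<dots>" using chain_ord_spmf_eqD[OF chain]
      by (rule chain_imageI) (auto simp: le_fun_def intro!: mult_right_mono)
    finally show "Complete_Partial_Order.chain (\<le>) ((\<lambda>p x. ennreal (spmf p x) * f x) ` Y)" .
  qed simp
  also have "\<dots> = (SUP p\<in>Y. \<integral>\<^sup>+ x. ennreal (spmf p x) * f x \<partial>count_space UNIV)"
    by (auto simp: nn_integral_count_space_indicator set_lub_spmf[OF chain] spmf_eq_0_set_spmf
        split: split_indicator intro!: arg_cong[of _ _ Sup] image_cong nn_integral_cong)
  finally show ?thesis
    by (simp add: nn_integral_measure_spmf)
qed

lemma nn_integral_return_spmf [simp]: "(\<integral>\<^sup>+ x. f x \<partial>measure_spmf (return_spmf a)) = f a"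
  by (simp add: nn_integral_measure_spmf' nn_integral_count_space_finite)

text \<open>\<open>bernoulli_pmf\<close> clamps its parameter; this is the resulting bias.\<close>

definition coin :: "real \<Rightarrow> real" where
  "coin p = min 1 (max 0 p)"

lemma nn_integral_bernoulli_clamped:
  "(\<integral>\<^sup>+ b. f b \<partial>measure_pmf (bernoulli_pmf p)) =
    ennreal (coin p) * f True + ennreal (1 - coin p) * f False"
proof -
  interpret pmf_as_function .
  have T: "pmf (bernoulli_pmf p) True = coin p"
    unfolding coin_def by transfer simp
  have F: "pmf (bernoulli_pmf p) False = 1 - coin p"
    unfolding coin_def by transfer simp
  have "(\<integral>\<^sup>+ b. f b \<partial>measure_pmf (bernoulli_pmf p)) =
      (\<Sum>b\<in>UNIV. f b * ennreal (pmf (bernoulli_pmf p) b))"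
    by (rule nn_integral_measure_pmf_support) auto
  also have "\<dots> = f False * ennreal (1 - coin p) + f True * ennreal (coin p)"
    by (simp only: UNIV_bool) (simp add: T F)
  finally show ?thesis
    by (simp only: mult.commute add.commute)
qed

section \<open>Expectation transformers of loop-free programs\<close>

fun loopfree :: "com \<Rightarrow> bool" where
  "loopfree (Seq c1 c2) \<longleftrightarrow> loopfree c1 \<and> loopfree c2"
| "loopfree (Cond b c1 c2) \<longleftrightarrow> loopfree c1 \<and> loopfree c2"
| "loopfree (While b c) \<longleftrightarrow> False"
| "loopfree _ \<longleftrightarrow> True"

fun time_bound :: "com \<Rightarrow> nat" where
  "time_bound (Seq c1 c2) = time_bound c1 + time_bound c2"
| "time_bound (Cond b c1 c2) = 1 + max (time_bound c1) (time_bound c2)"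
| "time_bound _ = 1"

text \<open>Expected value of \<open>f\<close> at the final store, ignoring time. It is meant for
  loop-free programs; the value at \<open>While\<close> is a placeholder.\<close>

fun wp :: "input \<Rightarrow> com \<Rightarrow> (store \<Rightarrow> ennreal) \<Rightarrow> store \<Rightarrow> ennreal" where
  "wp I Skip f s = f s"
| "wp I (NStore a i x) f s = f (nupdate a (nval I s i) (nval I s x) s)"
| "wp I (RStore a i x) f s = f (rupdate a (nval I s i) (rval I s x) s)"
| "wp I (Flip a i p) f s = ennreal (coin (rval I s p)) * f (nupdate a (nval I s i) 1 s)
     + ennreal (1 - coin (rval I s p)) * f (nupdate a (nval I s i) 0 s)"
| "wp I (Seq c1 c2) f s = wp I c1 (wp I c2 f) s"
| "wp I (Cond b c1 c2) f s = (if bval I s b then wp I c1 f s else wp I c2 f s)"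
| "wp I (While b c) f s = \<top>"


lemma exec_simps:
  "exec I Skip s = return_spmf (s, 1)"
  "exec I (NStore a i x) s = return_spmf (nupdate a (nval I s i) (nval I s x) s, 1)"
  "exec I (RStore a i y) s = return_spmf (rupdate a (nval I s i) (rval I s y) s, 1)"
  "exec I (Flip a i p) s = bind_spmf (spmf_of_pmf (bernoulli_pmf (rval I s p))) (\<lambda>b.
     return_spmf (nupdate a (nval I s i) (if b then 1 else 0) s, 1))"
  "exec I (Seq c1 c2) s = bind_spmf (exec I c1 s) (\<lambda>(s1, t1).
     bind_spmf (exec I c2 s1) (\<lambda>(s2, t2). return_spmf (s2, t1 + t2)))"
  "exec I (Cond b c1 c2) s = bind_spmf (exec I (if bval I s b then c1 else c2) s) (\<lambda>(s1, t1).
     return_spmf (s1, 1 + t1))"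
  by (subst exec.simps; simp)+

lemma  exec_While:
  "exec I (While b c) s = (if bval I s b then
     bind_spmf (exec I c s) (\<lambda>(s1, t1).
       bind_spmf (exec I (While b c) s1) (\<lambda>(s2, t2). return_spmf (s2, 1 + t1 + t2)))
     else return_spmf (s, 1))"
  by (subst exec.simps) simp

lemma nn_integral_exec_loopfree:
  "loopfree c \<Longrightarrow> (\<integral>\<^sup>+ (s', t). f s' \<partial>measure_spmf (exec I c s)) = wp I c f s"
proof (induction c arbitrary: s f)
  case (Flip a i p)
  then show ?case
    by (simp add: exec_simps nn_integral_bind_spmf nn_integral_bernoulli_clamped
        measure_spmf_spmf_of_pmf del: bind_spmf_of_pmf)
next
  case (Seq c1 c2)
  have "(\<integral>\<^sup>+ (s', t). f s' \<partial>measure_spmf (exec I (Seq c1 c2) s)) =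
    (\<integral>\<^sup>+ (s1, t1). (\<integral>\<^sup>+ (s2, t2). f s2 \<partial>measure_spmf (exec I c2 s1)) \<partial>measure_spmf (exec I c1 s))"
    by (simp add: exec_simps nn_integral_bind_spmf case_prod_unfold)
  then show ?case
    using Seq by simp
next
  case (Cond b c1 c2)
  then show ?case
    by (auto simp: exec_simps nn_integral_bind_spmf case_prod_unfold)
qed (simp_all add: exec_simps)

lemma exec_loopfree_time:
  "loopfree c \<Longrightarrow> (s', t) \<in> set_spmf (exec I c s) \<Longrightarrow> t \<le> time_bound c"
proof (induction c arbitrary: s s' t)
  case (Seq c1 c2)
  from Seq.prems obtain s1 t1 t2 where "(s1, t1) \<in> set_spmf (exec I c1 s)"
    "(s', t2) \<in> set_spmf (exec I c2 s1)" "t = t1 + t2"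
    by (auto simp: exec_simps set_bind_spmf)
  then show ?case
    using Seq.IH Seq.prems(1) by (auto intro!: add_mono)
next
  case (Cond b c1 c2)
  then show ?case
    by (fastforce simp: exec_simps set_bind_spmf le_max_iff_disj split: if_splits)
qed (auto simp: exec_simps set_bind_spmf simp del: bind_spmf_of_pmf)

lemma lossless_exec_loopfree: "loopfree c \<Longrightarrow> lossless_spmf (exec I c s)"
  by (induction c arbitrary: s) (auto simp: exec_simps simp del: bind_spmf_of_pmf)

lemma wp_mono: "(\<And>s. f s \<le> g s) \<Longrightarrow> wp I c f s \<le> wp I c g s"
proof (induction c arbitrary: f g s)
  case (Seq c1 c2)
  then show ?case by (simp add: Seq.IH)
qed (auto intro!: add_mono mult_left_mono)

lemma wp_add: "loopfree c \<Longrightarrow> wp I c (\<lambda>s. f s + g s) s = wp I c f s + wp I c g s"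
  by (simp flip: nn_integral_exec_loopfree add: case_prod_unfold nn_integral_add)

lemma wp_cmult: "loopfree c \<Longrightarrow> wp I c (\<lambda>s. a * f s) s = a * wp I c f s"
  by (simp flip: nn_integral_exec_loopfree add: case_prod_unfold nn_integral_cmult)

lemma wp_const: "loopfree c \<Longrightarrow> wp I c (\<lambda>_. a) s = a"
  using lossless_exec_loopfree[of c I s]
  by (simp flip: nn_integral_exec_loopfree
      add: lossless_spmf_def measure_spmf.emeasure_eq_measure case_prod_unfold space_measure_spmf)

section \<open>Expected cost, output and termination of a loop\<close>

text \<open>Fixpoint induction: every approximant of the loop stays below \<open>\<Psi>\<close>.
  \<open>\<kappa> = 1\<close> bounds the running time, an iteration costing at most \<open>K\<close>
  for the body and 1 for the guard; \<open>\<kappa> = 0\<close> bounds the probability of an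
  output.\<close>

lemma while_upper_bound:
  fixes f \<Psi> :: "store \<Rightarrow> ennreal" and \<kappa> :: ennreal
  assumes c: "loopfree c" "time_bound c \<le> K"
    and step: "\<And>s. bval I s b \<Longrightarrow> \<kappa> * of_nat (K + 1) + wp I c \<Psi> s \<le> \<Psi> s"
    and final: "\<And>s. \<not> bval I s b \<Longrightarrow> f s + \<kappa> \<le> \<Psi> s"
  shows "(\<integral>\<^sup>+ (s', t). f s' + \<kappa> * of_nat t \<partial>measure_spmf (exec I (While b c) s)) \<le> \<Psi> s"
proof -
  define J where "J p = (\<integral>\<^sup>+ (s', t). f s' + \<kappa> * of_nat t \<partial>measure_spmf p)" for p
  \<comment> \<open>The approximant \<open>g\<close> replaces \<open>exec\<close> in the body too.
    Carrying along that \<open>g\<close> lies below \<open>exec\<close> bounds the expectation over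
    the body by the one that \<open>wp\<close> computes.\<close>
  define P where "P g \<longleftrightarrow> (\<forall>d s. ord_spmf (=) (g I d s) (exec I d s)) \<and>
    (\<forall>s. J (g I (While b c) s) \<le> \<Psi> s)" for g
  have "P exec"
  proof (induction rule: exec.fixp_induct)
    case 1
    show ?case
    proof (rule ccpo.admissibleI)
      fix A :: "(((input \<times> com) \<times> store) \<Rightarrow> (store \<times> nat) spmf) set"
      assume chain: "Complete_Partial_Order.chain spmf.le_fun A" and ne: "A \<noteq> {}"
        and P: "\<forall>x\<in>A. P (curry (curry x))"
      let ?Y = "\<lambda>x. {y. \<exists>g\<in>A. y = g x}"
      have chain': "Complete_Partial_Order.chain (ord_spmf (=)) (?Y x)" for x
        by (rule chain_fun[OF chain])
      have ne': "?Y x \<noteq> {}" for x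
        using ne by auto
      have "ord_spmf (=) (lub_spmf (?Y ((I, d), s))) (exec I d s)" for d s
        using P by (intro lub_spmf_least[OF chain']) (auto simp: P_def)
      moreover have "J (lub_spmf (?Y ((I, While b c), s))) \<le> \<Psi> s" for s
        unfolding J_def nn_integral_lub_spmf[OF chain' ne']
        using P by (intro SUP_least) (auto simp: P_def J_def)
      ultimately show "P (curry (curry (spmf.lub_fun A)))"
        by (simp add: P_def fun_lub_def)
    qed
  next
    case 2
    show ?case
      by (simp add: P_def J_def measure_spmf_return_pmf_None)
  next
    case (3 g)
    then have ord: "ord_spmf (=) (g I d s) (exec I d s)" and bound: "J (g I (While b c) s) \<le> \<Psi> s" for d s
      by (auto simp: P_def)
    let ?g' = "\<lambda>s. if bval I s b then
      bind_spmf (g I c s) (\<lambda>(s1, t1).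
        bind_spmf (g I (While b c) s1) (\<lambda>(s2, t2). return_spmf (s2, 1 + t1 + t2)))
      else return_spmf (s, 1)"
    have "J (?g' s) \<le> \<Psi> s" for s
    proof (cases "bval I s b")
      case True
      have "J (?g' s) = (\<integral>\<^sup>+ (s1, t1). (\<integral>\<^sup>+ (s2, t2). \<kappa> * of_nat (1 + t1) + (f s2 + \<kappa> * of_nat t2)
          \<partial>measure_spmf (g I (While b c) s1)) \<partial>measure_spmf (g I c s))"
        using True by (simp add: J_def nn_integral_bind_spmf case_prod_unfold distrib_left add_ac)
      also have "\<dots> = (\<integral>\<^sup>+ (s1, t1). \<kappa> * of_nat (1 + t1) * weight_spmf (g I (While b c) s1)
          + J (g I (While b c) s1) \<partial>measure_spmf (g I c s))"
        by (simp add: J_def case_prod_unfold nn_integral_add space_measure_spmf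
            measure_spmf.emeasure_eq_measure)
      also have "\<dots> \<le> (\<integral>\<^sup>+ (s1, t1). \<kappa> * of_nat (1 + t1) * 1 + \<Psi> s1 \<partial>measure_spmf (g I c s))"
        by (intro nn_integral_mono) (unfold split_beta, intro add_mono mult_left_mono bound, auto simp: weight_spmf_le_1)
      also have "\<dots> \<le> (\<integral>\<^sup>+ (s1, t1). \<kappa> * of_nat (1 + t1) * 1 + \<Psi> s1 \<partial>measure_spmf (exec I c s))"
        by (rule nn_integral_ord_spmf_mono[OF ord])
      also have "\<dots> \<le> (\<integral>\<^sup>+ (s1, t1). \<kappa> * of_nat (K + 1) + \<Psi> s1 \<partial>measure_spmf (exec I c s))"
      proof (rule nn_integral_mono_AE, unfold AE_measure_spmf_iff, safe)
        fix s1 t1 assume "(s1, t1) \<in> set_spmf (exec I c s)"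
        then have "t1 \<le> K"
          using exec_loopfree_time[OF c(1)] c(2) by (meson le_trans)
        then show "\<kappa> * of_nat (1 + t1) * 1 + \<Psi> s1 \<le> \<kappa> * of_nat (K + 1) + \<Psi> s1"
          by (intro add_right_mono) (simp add: mult_left_mono)
      qed
      also have "\<dots> = \<kappa> * of_nat (K + 1) + wp I c \<Psi> s"
        by (simp add: nn_integral_exec_loopfree[OF c(1)] wp_add[OF c(1)] wp_const[OF c(1)])
      also have "\<dots> \<le> \<Psi> s"
        by (rule step[OF True])
      finally show ?thesis .
    qed (use final in \<open>simp add: J_def\<close>)
    moreover have "ord_spmf (=) (case d of
        Skip \<Rightarrow> return_spmf (s, 1)
      | NStore a i x \<Rightarrow> return_spmf (nupdate a (nval I s i) (nval I s x) s, 1)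
      | RStore a i x \<Rightarrow> return_spmf (rupdate a (nval I s i) (rval I s x) s, 1)
      | Flip a i p \<Rightarrow> bind_spmf (spmf_of_pmf (bernoulli_pmf (rval I s p))) (\<lambda>b.
          return_spmf (nupdate a (nval I s i) (if b then 1 else 0) s, 1))
      | Seq c1 c2 \<Rightarrow> bind_spmf (g I c1 s) (\<lambda>(s1, t1).
          bind_spmf (g I c2 s1) (\<lambda>(s2, t2). return_spmf (s2, t1 + t2)))
      | Cond b c1 c2 \<Rightarrow> bind_spmf (g I (if bval I s b then c1 else c2) s) (\<lambda>(s1, t1).
          return_spmf (s1, 1 + t1))
      | While b c1 \<Rightarrow>
          if bval I s b then
            bind_spmf (g I c1 s) (\<lambda>(s1, t1).
              bind_spmf (g I (While b c1) s1) (\<lambda>(s2, t2). return_spmf (s2, 1 + t1 + t2)))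
          else return_spmf (s, 1)) (exec I d s)" for d s
      by (subst exec.simps) (auto split: com.split intro!: bind_spmf_mono' ord)
    ultimately show ?case
      unfolding P_def by simp
  qed
  then show ?thesis
    by (simp add: P_def J_def)
qed

text \<open>The divergence probability \<open>D\<close> is preserved by an iteration while
  \<open>\<Phi>\<close> drops by at least 1, so \<open>m * D \<le> \<Phi>\<close> for every
  \<open>m\<close>; finiteness of \<open>\<Phi>\<close> then forces \<open>D = 0\<close>.\<close>

lemma while_lossless:
  fixes \<Phi> :: "store \<Rightarrow> ennreal"
  assumes c: "loopfree c"
    and step: "\<And>s. bval I s b \<Longrightarrow> 1 + wp I c \<Phi> s \<le> \<Phi> s"
    and fin: "\<Phi> s < \<top>"
  shows "lossless_spmf (exec I (While b c) s)"
proof -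
  define w where "w s = weight_spmf (exec I (While b c) s)" for s
  define D where "D s = ennreal (1 - w s)" for s
  have D_le: "D s \<le> 1" for s
    by (simp add: D_def w_def)
  have w_conv: "ennreal (w s) = (\<integral>\<^sup>+ x. 1 \<partial>measure_spmf (exec I (While b c) s))" for s
    by (simp add: w_def measure_spmf.emeasure_eq_measure space_measure_spmf)
  have wD: "ennreal (w s) + D s = 1" for s
    by (simp add: D_def w_def weight_spmf_le_1 flip: ennreal_plus)
  have w_step: "ennreal (w s) = wp I c (\<lambda>s1. ennreal (w s1)) s" if "bval I s b" for s
  proof -
    have "ennreal (w s) = (\<integral>\<^sup>+ (s1, t1). \<integral>\<^sup>+ x. 1 \<partial>measure_spmf (exec I (While b c) s1) \<partial>measure_spmf (exec I c s))"
      unfolding w_conv by (subst exec_While) (simp add: that nn_integral_bind_spmf case_prod_unfold del: nn_integral_const)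
    then show ?thesis
      by (simp add: w_conv nn_integral_exec_loopfree[OF c] del: nn_integral_const)
  qed
  have D_step: "D s = wp I c D s" if "bval I s b" for s
  proof -
    \<comment> \<open>Both sides are 1, and the finite \<open>w s\<close> can be cancelled.\<close>
    have "ennreal (w s) + D s = ennreal (w s) + wp I c D s"
      using wp_add[OF c, of I "\<lambda>s. ennreal (w s)" D s] w_step[OF that] wD[of s]
      by (simp add: wD wp_const[OF c])
    then show ?thesis
      by simp
  qed
  have D_final: "D s = 0" if "\<not> bval I s b" for s
  proof -
    have "exec I (While b c) s = return_spmf (s, 1)"
      by (subst exec_While) (simp add: that)
    then show ?thesis
      by (simp add: D_def w_def)
  qed
  have bound: "of_nat m * D s \<le> \<Phi> s" for m s
  proof (induction m arbitrary: s)
    case (Suc m)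
    show ?case
    proof (cases "bval I s b")
      case True
      have "of_nat (Suc m) * D s = D s + wp I c (\<lambda>s. of_nat m * D s) s"
        by (simp add: wp_cmult[OF c] distrib_right flip: D_step[OF True])
      also have "\<dots> \<le> 1 + wp I c \<Phi> s"
        by (intro add_mono D_le wp_mono Suc)
      also have "\<dots> \<le> \<Phi> s"
        by (rule step[OF True])
      finally show ?thesis .
    qed (simp add: D_final)
  qed simp
  obtain r where r: "\<Phi> s = ennreal r" "0 \<le> r"
    using fin by (cases "\<Phi> s") auto
  have "real m * (1 - w s) \<le> r" for m
  proof -
    have "ennreal (real m * (1 - w s)) \<le> ennreal r"
      using bound[of m s] r by (simp add: D_def ennreal_mult' ennreal_of_nat_eq_real_of_nat)
    then show ?thesis
      using r(2) by (simp add: ennreal_le_iff)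
  qed
  then have "1 - w s \<le> 0"
    using reals_Archimedean3 by (meson not_le)
  moreover have "w s \<le> 1"
    by (simp add: w_def weight_spmf_le_1)
  ultimately show ?thesis
    by (simp add: lossless_spmf_def flip: w_def)
qed


section \<open>The program\<close>

text \<open>
  Array 0 holds the pinned spins (0 is free). The scalars in array 1 are 0: number of answered queries, 1: height
  of the stack below the top, 2: mode (0 starts an update, 1 scans the neighbours), 3: coin, 4: first unused mark,
  5 and 6: vertex and spin being returned. Arrays 2 and 3 are the stack of vertices and neighbour positions;
  array 4 gives the start of the marks of a vertex in array 5.
\<close>

definition reg :: "nat \<Rightarrow> nexp" where "reg k = NLoad 1 (NConst k)"
definition TopV :: nexp where "TopV = NLoad 2 (reg 1)"
definition TopI :: nexp where "TopI = NLoad 3 (reg 1)"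
definition TopU :: nexp where "TopU = Nbr TopV TopI"

definition positive :: "nexp \<Rightarrow> bexp" where "positive x = NLess (NConst 0) x"

text \<open>An edge factor is the larger of the two possible ones iff replacing the spin
  \<open>b\<close> by the other spin \<open>3 - b\<close> does not increase it. The test thus works
  without knowing on which side of 1 the activity lies.\<close>

definition compat_test :: "nexp \<Rightarrow> nexp \<Rightarrow> nexp \<Rightarrow> nexp \<Rightarrow> bexp" where
  "compat_test v u a b = BNot (RLess (InteractionAt v u a b) (InteractionAt v u a (NSub (NConst 3) b)))"

text \<open>The coin value 1 becomes spin 1 and 0 becomes spin 2. A fresh block of marks is reserved
  in constant time, whereas clearing an old one would not be.\<close>

definition start_com :: com where
  "start_com =
    Seq (Flip 1 (NConst 3) (RDiv (FieldAt TopV (NConst 1)) (RAdd (FieldAt TopV (NConst 1)) (FieldAt TopV (NConst 2)))))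
    (Seq (NStore 0 TopV (NSub (NConst 2) (reg 3)))
    (Seq (NStore 4 TopV (reg 4))
    (Seq (NStore 1 (NConst 4) (NAdd (reg 4) NumVerts))
    (Seq (NStore 3 (reg 1) (NConst 0))
         (NStore 1 (NConst 2) (NConst 1))))))"

definition pass_com :: com where
  "pass_com =
    Seq (NStore 5 (NAdd (NLoad 4 TopV) TopU) (NConst 1))
        (NStore 3 (reg 1) (NAdd TopI (NConst 1)))"

definition restart_com :: com where
  "restart_com = Seq (NStore 0 TopV (NConst 0)) (NStore 1 (NConst 2) (NConst 0))"

text \<open>The bias \<open>q\<close> is the ratio of the smaller to the larger matrix entry,
  obtained from probes alone.\<close>

definition coin_com :: com where
  "coin_com = 
    (let same = InteractionAt TopV TopU (NConst 1) (NConst 1);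
         diff = InteractionAt TopV TopU (NConst 1) (NConst 2)
     in Cond (RLess same diff) (Flip 1 (NConst 3) (RDiv same diff)) (Flip 1 (NConst 3) (RDiv diff same)))"

definition push_com :: com where
  "push_com =
    Seq (NStore 2 (NAdd (reg 1) (NConst 1)) TopU)
    (Seq (NStore 1 (NConst 1) (NAdd (reg 1) (NConst 1)))
         (NStore 1 (NConst 2) (NConst 0)))"

text \<open>A pinned neighbour whose block has no mark for the current vertex is itself still being
  updated and has not put back this edge, so the edge is absent and is passed for free. Otherwise
  the coin decides first; a pinned neighbour is compared, a free one is sampled by a call.\<close>

definition probe_com :: com where
  "probe_com =
    Cond (BAnd (positive (NLoad 0 TopU)) (BNot (positive (NLoad 5 (NAdd (NLoad 4 TopU) TopV)))))
      pass_com
      (Seq coin_com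
        (Cond (positive (reg 3)) pass_com
          (Cond (positive (NLoad 0 TopU))
            (Cond (compat_test TopV TopU (NLoad 0 TopV) (NLoad 0 TopU)) pass_com restart_com)
            push_com)))"

text \<open>A recursive call hands its spin to the frame below and frees its vertex. At the bottom
  of the stack the spin stays pinned as the answer and the next query is loaded.\<close>

definition return_com :: com where
  "return_com =
    Cond (positive (reg 1))
      (Seq (NStore 1 (NConst 5) TopV)
      (Seq (NStore 1 (NConst 6) (NLoad 0 TopV))
      (Seq (NStore 0 TopV (NConst 0))
      (Seq (NStore 1 (NConst 1) (NSub (reg 1) (NConst 1)))
           (Cond (compat_test TopV (reg 5) (NLoad 0 TopV) (reg 6)) pass_com restart_com)))))
      (Seq (NStore 1 (NConst 0) (NAdd (reg 0) (NConst 1)))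
      (Seq (NStore 2 (NConst 0) (QueryAt (reg 0)))
           (NStore 1 (NConst 2) (NConst 0))))"

definition body :: com where
  "body = Cond (positive (reg 2)) (Cond (NLess TopU NumVerts) probe_com return_com) start_com"

definition sampler :: com where
  "sampler = Seq (NStore 2 (NConst 0) (QueryAt (NConst 0))) (While (NLess (reg 0) QuerySize) body)"

lemmas com_defs = reg_def TopV_def TopI_def TopU_def positive_def compat_test_def start_com_def pass_com_def
  restart_com_def coin_com_def push_com_def probe_com_def return_com_def body_def

lemma loopfree_body: "loopfree body"
  by (simp add: com_defs Let_def)

lemma time_bound_body: "time_bound body \<le> 20"
  by (simp add: com_defs Let_def)

lemma nmem_nupdate [simp]: "nmem (nupdate a i x s) = (nmem s)(a := (nmem s a)(i := x))"
  by (simp add: nupdate_def)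

text \<open>The head of the list is the top of the stack while array index 0 is its bottom, hence
  the reversal.\<close>

definition on_stack :: "(nat \<Rightarrow> nat) \<Rightarrow> (nat \<Rightarrow> nat) \<Rightarrow> (nat \<times> nat) list \<Rightarrow> bool" where
  "on_stack SV SI stk \<longleftrightarrow> (\<forall>j<length stk. rev stk ! j = (SV j, SI j))"

lemma on_stack_Nil [simp]: "on_stack SV SI []"
  by (simp add: on_stack_def)

lemma on_stack_Cons [simp]:
  "on_stack SV SI ((v, i) # stk) \<longleftrightarrow> SV (length stk) = v \<and> SI (length stk) = i \<and> on_stack SV SI stk"
  by (auto simp: on_stack_def nth_append less_Suc_eq)

lemma on_stack_upd:
  "length stk \<le> j \<Longrightarrow> on_stack (SV(j := x)) SI stk = on_stack SV SI stk"
  "length stk \<le> j \<Longrightarrow> on_stack SV (SI(j := x)) stk = on_stack SV SI stk"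
  by (auto simp: on_stack_def)


section \<open>Partition functions of partially pinned systems\<close>

text \<open>States of the abstract machine: \<open>Start\<close> begins an attempt at a vertex,
  \<open>Scan\<close> has put back the edges to its first neighbours. The arguments are the number
  of answered queries, the pinned spins, the vertex (with the neighbour position) and the frames
  below.\<close>

datatype astate =
    Start nat "nat \<Rightarrow> nat" nat "(nat \<times> nat) list"
  | Scan nat "nat \<Rightarrow> nat" nat nat "(nat \<times> nat) list"
  | Done "nat \<Rightarrow> nat"

text \<open>Edge factors are normalized to 1 for compatible spins and \<open>q\<close> for the
  others. Of the activity range only bounds on \<open>q\<close> are kept; those on its powers drive
  the cost analysis.\<close>

locale ising_sampler =
  fixes n :: nat and E :: "nat set set" and lam :: "nat \<Rightarrow> nat \<Rightarrow> real" and q :: real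
    and compat :: "nat \<Rightarrow> nat \<Rightarrow> bool" and adj :: "nat \<Rightarrow> nat list" and qs :: "nat list"
    and \<Delta> :: nat
  assumes edgesE: "\<And>e. e \<in> E \<Longrightarrow> \<exists>u<n. \<exists>v<n. u \<noteq> v \<and> e = {u, v}"
    and adj: "\<And>v. v < n \<Longrightarrow> distinct (adj v)" "\<And>v. v < n \<Longrightarrow> set (adj v) = {u. {u, v} \<in> E}"
    and lam_nonneg: "\<And>v c. v < n \<Longrightarrow> c \<in> {1, 2} \<Longrightarrow> 0 \<le> lam v c"
    and lam_pos: "\<And>v. v < n \<Longrightarrow> 0 < lam v 1 + lam v 2"
    and q: "0 < q" "q \<le> 1" "1/2 \<le> q ^ \<Delta>" "3/5 \<le> q ^ (\<Delta> - 1)"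
    and compat_sym: "\<And>a b. compat a b = compat b a"
    and degree: "\<And>v. v < n \<Longrightarrow> length (adj v) \<le> \<Delta>"
    and qs: "distinct qs" "set qs \<subseteq> {..<n}"
begin

definition fac :: "nat \<Rightarrow> nat \<Rightarrow> real" where
  "fac a b = (if compat a b then 1 else q)"

definition wt :: "nat set set \<Rightarrow> (nat \<Rightarrow> nat) \<Rightarrow> real" where
  "wt F \<sigma> = (\<Prod>v<n. lam v (\<sigma> v)) * (\<Prod>e\<in>F. fac (\<sigma> (Min e)) (\<sigma> (Max e)))"

text \<open>A partial configuration is a function into \<open>{0, 1, 2}\<close>, with 0 marking the free vertices.\<close>

definition Ext :: "(nat \<Rightarrow> nat) \<Rightarrow> (nat \<Rightarrow> nat) set" where
  "Ext \<eta> = {\<sigma> \<in> configs {..<n}. \<forall>v<n. \<eta> v \<noteq> 0 \<longrightarrow> \<sigma> v = \<eta> v}"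

definition Z :: "nat set set \<Rightarrow> (nat \<Rightarrow> nat) \<Rightarrow> real" where
  "Z F \<eta> = (\<Sum>\<sigma>\<in>Ext \<eta>. wt F \<sigma>)"

text \<open>Positive fields at the pinned spins keep every conditional partition function
  positive.\<close>

definition good :: "(nat \<Rightarrow> nat) \<Rightarrow> bool" where
  "good \<eta> \<longleftrightarrow> (\<forall>w. \<eta> w \<noteq> 0 \<longrightarrow> w < n \<and> \<eta> w \<in> {1, 2} \<and> 0 < lam w (\<eta> w))"

lemma finite_Ext [simp]: "finite (Ext \<eta>)"
  unfolding Ext_def configs_def by (simp add: finite_PiE)

lemma finite_E [simp]: "finite E"
  by (rule finite_subset[of _ "Pow {..<n}"]) (use edgesE in auto)

lemma fac_pos: "0 < fac a b" and fac_le_1: "fac a b \<le> 1" and fac_sym: "fac a b = fac b a"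
  using q compat_sym by (auto simp: fac_def)

lemma Ext_spin: "\<sigma> \<in> Ext \<eta> \<Longrightarrow> v < n \<Longrightarrow> \<sigma> v \<in> {1, 2}"
  by (auto simp: Ext_def configs_def PiE_def Pi_def)

lemma wt_nonneg: "\<sigma> \<in> Ext \<eta> \<Longrightarrow> 0 \<le> wt F \<sigma>"
  unfolding wt_def using Ext_spin[of \<sigma> \<eta>] lam_nonneg
  by (intro mult_nonneg_nonneg prod_nonneg) (auto intro: less_imp_le fac_pos)

lemma Z_nonneg: "0 \<le> Z F \<eta>"
  unfolding Z_def by (intro sum_nonneg wt_nonneg)

lemma Z_pos:
  assumes "good \<eta>"
  shows "0 < Z F \<eta>"
proof -
  define \<sigma> where "\<sigma> = (\<lambda>v. if v < n then if \<eta> v \<noteq> 0 then \<eta> v else if 0 < lam v 1 then 1 else 2 else undefined)"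
  have "\<sigma> \<in> Ext \<eta>"
    using assms by (auto simp: \<sigma>_def Ext_def configs_def good_def PiE_def extensional_def)
  moreover have "0 < lam v (\<sigma> v)" if "v < n" for v
    using that assms lam_pos[of v] by (auto simp: \<sigma>_def good_def)
  then have "0 < wt F \<sigma>"
    unfolding wt_def by (intro mult_pos_pos prod_pos) (auto intro: fac_pos)
  ultimately show ?thesis
    unfolding Z_def by (intro sum_pos2[of _ \<sigma>]) (auto intro: wt_nonneg)
qed

lemma Ext_upd:
  assumes "v < n" "\<eta> v = 0" "c \<noteq> 0"
  shows "\<sigma> \<in> Ext (\<eta>(v := c)) \<longleftrightarrow> \<sigma> \<in> Ext \<eta> \<and> \<sigma> v = c"
proof -
  have "(\<forall>w<n. (\<eta>(v := c)) w \<noteq> 0 \<longrightarrow> \<sigma> w = (\<eta>(v := c)) w) \<longleftrightarrow>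
      (\<forall>w<n. \<eta> w \<noteq> 0 \<longrightarrow> \<sigma> w = \<eta> w) \<and> \<sigma> v = c"
    using assms by (metis fun_upd_apply)
  then show ?thesis
    by (simp only: Ext_def mem_Collect_eq) blast
qed

lemma Ext_recolour:
  assumes "\<sigma> \<in> Ext \<eta>" "v < n" "\<eta> v = 0" "b \<in> {1, 2}"
  shows "\<sigma>(v := b) \<in> Ext \<eta>"
  using assms unfolding Ext_def configs_def by (simp add: PiE_iff extensional_def)

lemma sum_Ext_split:
  fixes g :: "(nat \<Rightarrow> nat) \<Rightarrow> real"
  assumes "v < n" "\<eta> v = 0"
  shows "sum g (Ext \<eta>) = sum g (Ext (\<eta>(v := 1))) + sum g (Ext (\<eta>(v := 2)))"
proof -
  have "Ext \<eta> = Ext (\<eta>(v := 1)) \<union> Ext (\<eta>(v := 2))"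
    using Ext_upd[of v \<eta>] Ext_spin[of _ \<eta> v] assms by (intro set_eqI) fastforce
  moreover have "Ext (\<eta>(v := 1)) \<inter> Ext (\<eta>(v := 2)) = {}"
    using Ext_upd[of v \<eta>] assms by auto
  ultimately show ?thesis
    by (simp add: sum.union_disjoint)
qed

lemma Z_split: "v < n \<Longrightarrow> \<eta> v = 0 \<Longrightarrow> Z F \<eta> = Z F (\<eta>(v := 1)) + Z F (\<eta>(v := 2))"
  unfolding Z_def by (rule sum_Ext_split)

text \<open>Edge factors are at most 1, so further edges only decrease each weight. This makes the
  ratios of partition functions used below probabilities.\<close>

lemma Z_mono:
  assumes "F' \<subseteq> F" "F \<subseteq> E"
  shows "Z F \<eta> \<le> Z F' \<eta>"
  unfolding Z_def
proof (rule sum_mono)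
  fix \<sigma> assume \<sigma>: "\<sigma> \<in> Ext \<eta>"
  have fin: "finite F"
    by (rule finite_subset[OF assms(2) finite_E])
  have "(\<Prod>e\<in>F. fac (\<sigma> (Min e)) (\<sigma> (Max e))) =
      (\<Prod>e\<in>F - F'. fac (\<sigma> (Min e)) (\<sigma> (Max e))) * (\<Prod>e\<in>F'. fac (\<sigma> (Min e)) (\<sigma> (Max e)))"
    by (rule prod.subset_diff[OF assms(1) fin])
  then have "wt F \<sigma> = (\<Prod>e\<in>F - F'. fac (\<sigma> (Min e)) (\<sigma> (Max e))) * wt F' \<sigma>"
    by (simp add: wt_def)
  also have "\<dots> \<le> 1 * wt F' \<sigma>"
    using \<sigma> by (intro mult_right_mono prod_le_1 wt_nonneg)
      (auto simp: fac_le_1 intro: less_imp_le fac_pos)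
  finally show "wt F \<sigma> \<le> wt F' \<sigma>"
    by simp
qed

lemma wt_insert:
  assumes "finite F" "{v, u} \<notin> F" "v \<noteq> u"
  shows "wt (insert {v, u} F) \<sigma> = fac (\<sigma> v) (\<sigma> u) * wt F \<sigma>"
proof -
  have "fac (\<sigma> (Min {v, u})) (\<sigma> (Max {v, u})) = fac (\<sigma> v) (\<sigma> u)"
    using assms(3) fac_sym by (cases "v < u") (auto simp: min_def max_def)
  then show ?thesis
    using assms by (simp add: wt_def)
qed

lemma Z_insert_pinned:
  assumes "finite F" "{v, u} \<notin> F" "v \<noteq> u" "v < n" "u < n" "\<eta> v \<noteq> 0" "\<eta> u \<noteq> 0"
  shows "Z (insert {v, u} F) \<eta> = fac (\<eta> v) (\<eta> u) * Z F \<eta>"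
  unfolding Z_def sum_distrib_left
  by (rule sum.cong) (use assms in \<open>auto simp: wt_insert Ext_def\<close>)

lemma Z_insert_free:
  assumes "finite F" "{v, u} \<notin> F" "v \<noteq> u" "v < n" "u < n" "\<eta> v \<noteq> 0" "\<eta> u = 0"
  shows "Z (insert {v, u} F) \<eta> = fac (\<eta> v) 1 * Z F (\<eta>(u := 1)) + fac (\<eta> v) 2 * Z F (\<eta>(u := 2))"
  using Z_insert_pinned[of F v u "\<eta>(u := 1)"] Z_insert_pinned[of F v u "\<eta>(u := 2)"] assms
  by (subst Z_split[of u]) auto

text \<open>Without edges at \<open>v\<close> each weight is the field at \<open>v\<close> times a
  rest \<open>r\<close> that ignores the spin of \<open>v\<close>, so the law of \<open>v\<close> is
  its normalized field. The product form also covers vanishing fields.\<close>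

lemma Z_isolated:
  assumes F: "F \<subseteq> E" "\<And>e. e \<in> F \<Longrightarrow> v \<notin> e" and v: "v < n" "\<eta> v = 0" and c: "c \<in> {1, 2}"
  shows "(lam v 1 + lam v 2) * Z F (\<eta>(v := c)) = lam v c * Z F \<eta>"
proof -
  define r where "r \<sigma> = (\<Prod>w\<in>{..<n} - {v}. lam w (\<sigma> w)) * (\<Prod>e\<in>F. fac (\<sigma> (Min e)) (\<sigma> (Max e)))" for \<sigma>
  define R where "R = sum r (Ext (\<eta>(v := 1)))"
  have wt_r: "wt F \<sigma> = lam v (\<sigma> v) * r \<sigma>" for \<sigma>
    using v(1) by (simp add: wt_def r_def prod.remove[of "{..<n}" v])
  have ends: "Min e \<noteq> v \<and> Max e \<noteq> v" if "e \<in> F" for e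
  proof -
    have "finite e" "e \<noteq> {}"
      using F(1) that edgesE[of e] by auto
    then have "Min e \<in> e" "Max e \<in> e"
      by simp_all
    then show ?thesis
      using F(2)[OF that] by auto
  qed
  have r_upd: "r (\<sigma>(v := d)) = r \<sigma>" for \<sigma> d
    unfolding r_def using ends by (intro arg_cong2[of _ _ _ _ "(*)"] prod.cong) auto
  have Z_R: "Z F (\<eta>(v := d)) = lam v d * R" if d: "d \<in> {1, 2}" for d
  proof -
    have "Z F (\<eta>(v := d)) = lam v d * sum r (Ext (\<eta>(v := d)))"
      unfolding Z_def sum_distrib_left
      by (rule sum.cong) (use v d in \<open>auto simp: wt_r Ext_def\<close>)
    also have "sum r (Ext (\<eta>(v := d))) = R"
      unfolding R_def
      by (rule sum.reindex_bij_witness[of _ "\<lambda>\<sigma>. \<sigma>(v := d)" "\<lambda>\<sigma>. \<sigma>(v := 1)"])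
        (use d v Ext_upd[of v \<eta>] Ext_recolour[of _ \<eta> v] in \<open>auto simp: r_upd fun_upd_idem_iff\<close>)
    finally show ?thesis .
  qed
  show ?thesis
    using c by (auto simp: Z_split[of v \<eta> F] v Z_R algebra_simps)
qed

text \<open>
  A stack entry \<open>(w, i)\<close> is a vertex whose update is in progress and has passed
  the edges to its first \<open>i\<close> neighbours; the remaining ones are not yet part of the graph.
\<close>

definition pending :: "(nat \<times> nat) list \<Rightarrow> nat set set" where
  "pending stk = (\<Union>(w, i)\<in>set stk. (\<lambda>u. {w, u}) ` set (drop i (adj w)))"

text \<open>The graph in which a call made above the frames \<open>stk\<close> has to sample its
  vertex.\<close>

definition active :: "(nat \<times> nat) list \<Rightarrow> nat set set" where
  "active stk = E - pending stk"

lemma active_subset: "active stk \<subseteq> E"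
  by (auto simp: active_def)

lemma finite_active [simp]: "finite (active stk)"
  by (simp add: active_def)

lemma active_Nil [simp]: "active [] = E"
  by (simp add: active_def pending_def)

lemma active_done: "length (adj v) \<le> i \<Longrightarrow> active ((v, i) # stk) = active stk"
  by (simp add: active_def pending_def)

lemma active_fresh: 
  assumes "v < n" "e \<in> active ((v, 0) # stk)"
  shows "v \<notin> e"
proof
  assume "v \<in> e"
  moreover have "e \<in> E"
    using assms by (simp add: active_def)
  ultimately obtain u where "e = {u, v}"
    using edgesE[of e] by auto
  then show False
    using assms adj(2)[of v] \<open>e \<in> E\<close> by (auto simp: active_def pending_def insert_commute)
qed

lemma adj_nth:
  assumes "v < n" "i < length (adj v)"
  shows "adj v ! i < n" "adj v ! i \<noteq> v" "{v, adj v ! i} \<in> E"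
proof -
  have "adj v ! i \<in> set (adj v)"
    using assms by simp
  then show *: "{v, adj v ! i} \<in> E"
    using adj(2)[of v] assms by (auto simp: insert_commute)
  show "adj v ! i < n" "adj v ! i \<noteq> v"
    using edgesE[OF *] by (auto simp: doubleton_eq_iff)
qed

text \<open>Since \<open>adj v\<close> is distinct, the frame of \<open>v\<close> withholds this
  edge at one position only. Once passed, the edge appears, unless a frame below withholds it as
  well.\<close>

lemma active_step:
  assumes v: "v < n" "i < length (adj v)"
  shows "active ((v, Suc i) # stk) =
      (if {v, adj v ! i} \<in> active stk then insert {v, adj v ! i} (active ((v, i) # stk))
       else active ((v, i) # stk))"
    and "{v, adj v ! i} \<notin> active ((v, i) # stk)"
proof -
  have drop: "drop i (adj v) = adj v ! i # drop (Suc i) (adj v)"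
    by (rule Cons_nth_drop_Suc[symmetric]) (rule v(2))
  have "distinct (drop i (adj v))"
    using adj(1)[OF v(1)] by simp
  then have notin: "adj v ! i \<notin> set (drop (Suc i) (adj v))"
    unfolding drop by simp
  have ne: "adj v ! i \<noteq> v"
    using adj_nth[OF v] by simp
  have "{v, adj v ! i} \<notin> (\<lambda>u. {v, u}) ` set (drop (Suc i) (adj v))"
    using notin by (auto simp: doubleton_eq_iff)
  then show "active ((v, Suc i) # stk) =
      (if {v, adj v ! i} \<in> active stk then insert {v, adj v ! i} (active ((v, i) # stk))
       else active ((v, i) # stk))"
    using adj_nth(3)[OF v] by (auto simp: active_def pending_def drop)
  show "{v, adj v ! i} \<notin> active ((v, i) # stk)"
    by (auto simp: active_def pending_def drop)
qed


section \<open>Output probability and cost of the stack machine\<close>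

text \<open>The conditional probability, given the pins \<open>\<eta>\<close>, that the query
  vertices read \<open>\<tau>\<close>.\<close>

definition target :: "(nat \<Rightarrow> nat) \<Rightarrow> (nat \<Rightarrow> nat) \<Rightarrow> real" where
  "target \<tau> \<eta> = (\<Sum>\<sigma> | \<sigma> \<in> Ext \<eta> \<and> restrict \<sigma> (set qs) = \<tau>. wt E \<sigma>) / Z E \<eta>"

text \<open>Expectation of \<open>h\<close> at a spin of \<open>v\<close> drawn from its exact
  conditional law in the current graph.\<close>

definition free_val :: "(nat \<Rightarrow> real) \<Rightarrow> nat \<Rightarrow> (nat \<times> nat) list \<Rightarrow> (nat \<Rightarrow> nat) \<Rightarrow> real" where
  "free_val h v stk \<eta> =
    (Z (active stk) (\<eta>(v := 1)) * h 1 + Z (active stk) (\<eta>(v := 2)) * h 2) / Z (active stk) \<eta>"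

text \<open>Probability that all remaining edges pass: each one multiplies the partition function by
  its own passing probability, and the product telescopes.\<close>

definition accept_prob :: "nat \<Rightarrow> nat \<Rightarrow> (nat \<times> nat) list \<Rightarrow> (nat \<Rightarrow> nat) \<Rightarrow> real" where
  "accept_prob v i stk \<eta> = Z (active stk) \<eta> / Z (active ((v, i) # stk)) \<eta>"

text \<open>On acceptance the current spin is handed on; on rejection the restarted update produces
  an exact conditional sample.\<close>

definition scan_val :: "(nat \<Rightarrow> real) \<Rightarrow> nat \<Rightarrow> nat \<Rightarrow> (nat \<times> nat) list \<Rightarrow> (nat \<Rightarrow> nat) \<Rightarrow> real" where
  "scan_val h v i stk \<eta> = accept_prob v i stk \<eta> * h (\<eta> v)
    + (1 - accept_prob v i stk \<eta>) * free_val h v stk (\<eta>(v := 0))"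

text \<open>
  The probability of the final output \<open>\<tau>\<close> once the recursive call for \<open>u\<close> has returned \<open>d\<close>,
  as a function of the frames below that call.
\<close>

fun ret_val :: "(nat \<Rightarrow> nat) \<Rightarrow> (nat \<times> nat) list \<Rightarrow> (nat \<Rightarrow> nat) \<Rightarrow> nat \<Rightarrow> nat \<Rightarrow> real" where
  "ret_val \<tau> [] \<eta> u d = target \<tau> (\<eta>(u := d))"
| "ret_val \<tau> ((v, i) # stk) \<eta> u d =
    (if compat (\<eta> v) d then scan_val (ret_val \<tau> stk (\<eta>(v := 0)) v) v (Suc i) stk \<eta>
     else free_val (ret_val \<tau> stk (\<eta>(v := 0)) v) v stk (\<eta>(v := 0)))"

lemma target_nonneg: "0 \<le> target \<tau> \<eta>"
  unfolding target_def by (intro divide_nonneg_nonneg sum_nonneg Z_nonneg) (auto intro: wt_nonneg)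

lemma free_val_nonneg: "(\<And>d. 0 \<le> h d) \<Longrightarrow> 0 \<le> free_val h v stk \<eta>"
  unfolding free_val_def by (intro divide_nonneg_nonneg add_nonneg_nonneg mult_nonneg_nonneg Z_nonneg)

lemma active_Cons_subset: "active ((v, i) # stk) \<subseteq> active stk"
  by (auto simp: active_def pending_def)

lemma Z_mono_active: "Z (active stk) \<eta> \<le> Z (active ((v, i) # stk)) \<eta>"
  by (rule Z_mono[OF active_Cons_subset active_subset])

lemma accept_prob_nonneg: "0 \<le> accept_prob v i stk \<eta>"
  unfolding accept_prob_def by (intro divide_nonneg_nonneg Z_nonneg)

lemma accept_prob_le_1: "accept_prob v i stk \<eta> \<le> 1"
  using Z_mono_active[of stk \<eta> v i] Z_nonneg[of "active ((v, i) # stk)" \<eta>]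
  unfolding accept_prob_def divide_le_eq_1 by linarith

lemma scan_val_nonneg: "(\<And>d. 0 \<le> h d) \<Longrightarrow> 0 \<le> scan_val h v i stk \<eta>"
  unfolding scan_val_def using accept_prob_nonneg accept_prob_le_1 free_val_nonneg[of h]
  by (intro add_nonneg_nonneg mult_nonneg_nonneg) auto

lemma ret_val_nonneg: "0 \<le> ret_val \<tau> stk \<eta> u d"
  by (induction \<tau> stk \<eta> u d rule: ret_val.induct) (auto intro!: target_nonneg free_val_nonneg scan_val_nonneg simp del: fun_upd_apply)

lemma good_upd_0: "good \<eta> \<Longrightarrow> good (\<eta>(v := 0))"
  by (auto simp: good_def)

lemma good_upd: "good \<eta> \<Longrightarrow> v < n \<Longrightarrow> c \<in> {1, 2} \<Longrightarrow> 0 < lam v c \<Longrightarrow> good (\<eta>(v := c))"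
  by (auto simp: good_def)

text \<open>Rejection sampling: drawing \<open>c\<close> and then accepting has probability \<open>Z
  (active stk) (\<eta>(v := c)) / Z (active ((v, 0) # stk)) \<eta>\<close>, which is proportional to
  the conditional law of \<open>v\<close>. The rejected mass restarts and so has the value
  \<open>free_val\<close> again.\<close>

lemma free_val_start:
  assumes "good \<eta>" "v < n" "\<eta> v = 0"
  shows "free_val h v stk \<eta> = lam v 1 / (lam v 1 + lam v 2) * scan_val h v 0 stk (\<eta>(v := 1))
    + lam v 2 / (lam v 1 + lam v 2) * scan_val h v 0 stk (\<eta>(v := 2))"
proof -
  let ?F = "active stk" and ?N = "active ((v, 0) # stk)" and ?V = "free_val h v stk \<eta>"
  let ?p = "\<lambda>c. lam v c / (lam v 1 + lam v 2)"
  have upd: "\<eta>(v := c, v := 0) = \<eta>" for c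
    using assms(3) by auto
  have pos: "0 < Z ?N \<eta>" "0 < Z ?F \<eta>" "0 < lam v 1 + lam v 2"
    using Z_pos assms(1) lam_pos assms(2) by auto
  have *: "?p c * accept_prob v 0 stk (\<eta>(v := c)) = Z ?F (\<eta>(v := c)) / Z ?N \<eta>" if c: "c \<in> {1, 2}" for c
  proof -
    have iso: "(lam v 1 + lam v 2) * Z ?N (\<eta>(v := c)) = lam v c * Z ?N \<eta>"
      by (rule Z_isolated[where F = ?N and v = v]) (use assms c active_subset active_fresh[OF assms(2)] in auto)
    show ?thesis
    proof (cases "Z ?N (\<eta>(v := c)) = 0")
      \<comment> \<open>If the denominator of \<open>accept_prob\<close> vanishes, so does the
        smaller numerator, and both sides are 0.\<close>
      case True
      then have "Z ?F (\<eta>(v := c)) = 0"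
        using Z_mono_active[of stk "\<eta>(v := c)" v 0] Z_nonneg[of ?F "\<eta>(v := c)"] by simp
      then show ?thesis
        by (simp add: accept_prob_def)
    next
      case False
      then have "lam v c = (lam v 1 + lam v 2) * Z ?N (\<eta>(v := c)) / Z ?N \<eta>"
        using iso pos by (simp add: field_simps)
      then have p: "?p c = Z ?N (\<eta>(v := c)) / Z ?N \<eta>"
        using pos(3) by simp
      show ?thesis
        unfolding accept_prob_def p using False by simp
    qed
  qed
  have "?p c * scan_val h v 0 stk (\<eta>(v := c)) =
      Z ?F (\<eta>(v := c)) / Z ?N \<eta> * h c + (?p c - Z ?F (\<eta>(v := c)) / Z ?N \<eta>) * ?V"
    if c: "c \<in> {1, 2}" for c
    unfolding scan_val_def upd *[OF c, symmetric] by (simp add: algebra_simps)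
  note this[of 1] this[of 2]
  moreover have "(Z ?F (\<eta>(v := 1)) + Z ?F (\<eta>(v := 2))) / Z ?N \<eta> * ?V =
      Z ?F (\<eta>(v := 1)) / Z ?N \<eta> * h 1 + Z ?F (\<eta>(v := 2)) / Z ?N \<eta> * h 2"
  proof -
    have "Z ?F (\<eta>(v := 1)) + Z ?F (\<eta>(v := 2)) = Z ?F \<eta>"
      using Z_split[of v \<eta> ?F] assms by simp
    then show ?thesis
      unfolding free_val_def using pos by (simp flip: add_divide_distrib)
  qed
  moreover have "?p 1 + ?p 2 = 1"
    using pos(3) by (simp flip: add_divide_distrib)
  then have "?p 1 * ?V + ?p 2 * ?V = ?V"
    by (metis distrib_right mult_1)
  ultimately show ?thesis
    by (simp add: algebra_simps add_divide_distrib)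
qed

lemma scan_val_done:
  assumes "good \<eta>" "length (adj v) \<le> i"
  shows "scan_val h v i stk \<eta> = h (\<eta> v)"
  using Z_pos[OF assms(1), of "active stk"] by (simp add: scan_val_def accept_prob_def active_done[OF assms(2)])

lemma scan_val_skip:
  assumes "v < n" "i < length (adj v)" "{v, adj v ! i} \<notin> active stk"
  shows "scan_val h v (Suc i) stk \<eta> = scan_val h v i stk \<eta>"
  using assms by (simp add: scan_val_def accept_prob_def active_step)

text \<open>\<open>\<rho>\<close> is the probability that the edge at position \<open>i\<close>
  passes; it is the factor between consecutive acceptance probabilities.\<close>

lemma scan_val_combine:
  assumes "good \<eta>" "Z (active ((v, Suc i) # stk)) \<eta> = \<rho> * Z (active ((v, i) # stk)) \<eta>"
  shows "scan_val h v i stk \<eta> =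
    \<rho> * scan_val h v (Suc i) stk \<eta> + (1 - \<rho>) * free_val h v stk (\<eta>(v := 0))"
proof -
  have "0 < Z (active ((v, i) # stk)) \<eta>" "0 < Z (active ((v, Suc i) # stk)) \<eta>"
    using Z_pos[OF assms(1)] by auto
  then have "accept_prob v i stk \<eta> = \<rho> * accept_prob v (Suc i) stk \<eta>"
    using assms(2) by (auto simp: accept_prob_def)
  then show ?thesis
    by (simp add: scan_val_def algebra_simps)
qed

text \<open>Coin and comparison together pass with probability 1 for compatible spins and
  \<open>q\<close> otherwise, which is the edge factor \<open>fac\<close>.\<close>

lemma scan_val_pinned:
  assumes "good \<eta>" "v < n" "i < length (adj v)" "u = adj v ! i" "{v, u} \<in> active stk" "\<eta> v \<noteq> 0" "\<eta> u \<noteq> 0"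
  shows "scan_val h v i stk \<eta> = q * scan_val h v (Suc i) stk \<eta> + (1 - q) *
    (if compat (\<eta> v) (\<eta> u) then scan_val h v (Suc i) stk \<eta> else free_val h v stk (\<eta>(v := 0)))"
proof -
  have "Z (active ((v, Suc i) # stk)) \<eta> = fac (\<eta> v) (\<eta> u) * Z (active ((v, i) # stk)) \<eta>"
    using assms adj_nth[OF assms(2,3)] active_step[OF assms(2,3), of stk] by (simp add: Z_insert_pinned)
  from scan_val_combine[OF assms(1) this, of h] show ?thesis
    by (auto simp: fac_def algebra_simps)
qed

text \<open>
  Passing the edge to \<open>u\<close> without looking has probability \<open>q\<close>; the remaining probability is
  decided by a sample of \<open>u\<close> from the graph without that edge.
\<close>

lemma scan_val_free:
  fixes \<tau> \<eta> stk v
  defines "h \<equiv> ret_val \<tau> stk (\<eta>(v := 0)) v"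
  assumes "good \<eta>" "v < n" "i < length (adj v)" "u = adj v ! i" "{v, u} \<in> active stk" "\<eta> v \<noteq> 0" "\<eta> u = 0"
  shows "scan_val h v i stk \<eta> = q * scan_val h v (Suc i) stk \<eta> + (1 - q) *
    free_val (ret_val \<tau> ((v, i) # stk) \<eta> u) u ((v, i) # stk) \<eta>"
proof -
  let ?F = "active ((v, i) # stk)"
  \<comment> \<open>The conditional law of \<open>u\<close> in the graph without the edge; the edge
    passes with the mean of its factor under this law.\<close>
  define \<pi> where "\<pi> d = Z ?F (\<eta>(u := d)) / Z ?F \<eta>" for d
  have pos: "0 < Z ?F \<eta>"
    by (rule Z_pos) fact
  have u: "u < n" "u \<noteq> v"
    using adj_nth[OF assms(3,4)] assms(5) by auto
  have sum: "\<pi> 1 + \<pi> 2 = 1"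
    using pos Z_split[of u \<eta> ?F] u assms(8) by (simp add: \<pi>_def flip: add_divide_distrib)
  have "Z (active ((v, Suc i) # stk)) \<eta> = fac (\<eta> v) 1 * Z ?F (\<eta>(u := 1)) + fac (\<eta> v) 2 * Z ?F (\<eta>(u := 2))"
    using assms u active_step[OF assms(3,4), of stk] by (simp add: Z_insert_free)
  also have "\<dots> = (fac (\<eta> v) 1 * \<pi> 1 + fac (\<eta> v) 2 * \<pi> 2) * Z ?F \<eta>"
    using pos by (simp add: \<pi>_def field_simps)
  finally have e1: "scan_val h v i stk \<eta> = (fac (\<eta> v) 1 * \<pi> 1 + fac (\<eta> v) 2 * \<pi> 2) * scan_val h v (Suc i) stk \<eta>
      + (1 - (fac (\<eta> v) 1 * \<pi> 1 + fac (\<eta> v) 2 * \<pi> 2)) * free_val h v stk (\<eta>(v := 0))"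
    by (rule scan_val_combine[OF assms(2)])
  have e2: "free_val (ret_val \<tau> ((v, i) # stk) \<eta> u) u ((v, i) # stk) \<eta> =
      \<pi> 1 * ret_val \<tau> ((v, i) # stk) \<eta> u 1 + \<pi> 2 * ret_val \<tau> ((v, i) # stk) \<eta> u 2"
    by (simp add: free_val_def \<pi>_def add_divide_distrib)
  have pi2: "\<pi> 2 = 1 - \<pi> 1"
    using sum by simp
  show ?thesis
    unfolding e1 e2 pi2 ret_val.simps h_def[symmetric] fac_def by (simp add: algebra_simps)
qed

text \<open>Tower property: the weights \<open>Z E (\<eta>(v := d))\<close> cancel the denominators
  of \<open>target\<close>.\<close>

lemma free_val_root:
  assumes "good \<eta>" "v < n" "\<eta> v = 0"
  shows "free_val (ret_val \<tau> [] \<eta> v) v [] \<eta> = target \<tau> \<eta>"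
proof -
  define g where "g \<sigma> = (if restrict \<sigma> (set qs) = \<tau> then wt E \<sigma> else 0)" for \<sigma>
  have tgt: "target \<tau> \<eta>' = sum g (Ext \<eta>') / Z E \<eta>'" for \<eta>'
    by (simp add: target_def g_def sum.inter_filter)
  have "Z E \<eta>' * target \<tau> \<eta>' = sum g (Ext \<eta>')" for \<eta>'
  proof (cases "Z E \<eta>' = 0")
    \<comment> \<open>The numerator of \<open>target\<close> lies between 0 and \<open>Z\<close>, so
      it vanishes together with \<open>Z\<close>.\<close>
    case True
    have "sum g (Ext \<eta>') \<le> Z E \<eta>'" "0 \<le> sum g (Ext \<eta>')"
      unfolding Z_def g_def by (auto intro!: sum_mono sum_nonneg intro: wt_nonneg)
    then show ?thesis
      using True by simp
  qed (simp add: tgt)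
  then show ?thesis
    using sum_Ext_split[of v \<eta> g] assms(2,3) by (simp add: free_val_def tgt)
qed

lemma target_final:
  assumes "good \<eta>" "\<And>w. w \<in> set qs \<Longrightarrow> \<eta> w \<noteq> 0" "restrict \<eta> (set qs) = \<tau>"
  shows "target \<tau> \<eta> = 1"
proof -
  have "{\<sigma> \<in> Ext \<eta>. restrict \<sigma> (set qs) = \<tau>} = Ext \<eta>"
  proof -
    have "restrict \<sigma> (set qs) = restrict \<eta> (set qs)" if "\<sigma> \<in> Ext \<eta>" for \<sigma>
      using that assms(2) qs(2) by (intro restrict_ext) (auto simp: Ext_def)
    then show ?thesis
      using assms(3) by auto
  qed
  then show ?thesis
    using Z_pos[OF assms(1), of E] by (simp add: target_def Z_def)
qed

section \<open>The abstract machine and its output martingale\<close>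

text \<open>The chain of callers: each caller is a neighbour of the vertex it called and, its
  position not yet advanced, still withholds the edge to it.\<close>

fun linked :: "nat \<Rightarrow> nat \<Rightarrow> (nat \<times> nat) list \<Rightarrow> bool" where
  "linked k v [] \<longleftrightarrow> k < length qs \<and> v = qs ! k"
| "linked k v ((w, i) # stk) \<longleftrightarrow> w < n \<and> i < length (adj w) \<and> adj w ! i = v \<and> linked k w stk"

text \<open>Pinned are exactly the answered queries and the vertices being updated. Calls go to free
  vertices only, so no vertex is on the stack twice.\<close>

fun invar :: "astate \<Rightarrow> bool" where
  "invar (Start k \<eta> v stk) \<longleftrightarrow> good \<eta> \<and> {w. \<eta> w \<noteq> 0} = set (take k qs) \<union> fst ` set stk \<and> \<eta> v = 0 \<and>
     distinct (map fst stk) \<and> set (take k qs) \<inter> fst ` set stk = {} \<and> linked k v stk"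
| "invar (Scan k \<eta> v i stk) \<longleftrightarrow> good \<eta> \<and> {w. \<eta> w \<noteq> 0} = set (take k qs) \<union> insert v (fst ` set stk) \<and>
     distinct (v # map fst stk) \<and> set (take k qs) \<inter> insert v (fst ` set stk) = {} \<and> linked k v stk \<and>
     i \<le> length (adj v)"
| "invar (Done \<eta>) \<longleftrightarrow> good \<eta> \<and> {w. \<eta> w \<noteq> 0} = set qs"

text \<open>One step of the machine as an expectation transformer; coin tosses become convex
  combinations.\<close>

fun astep :: "(astate \<Rightarrow> ennreal) \<Rightarrow> astate \<Rightarrow> ennreal" where
  "astep g (Start k \<eta> v stk) =
     ennreal (lam v 1 / (lam v 1 + lam v 2)) * g (Scan k (\<eta>(v := 1)) v 0 stk)
     + ennreal (1 - lam v 1 / (lam v 1 + lam v 2)) * g (Scan k (\<eta>(v := 2)) v 0 stk)"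
| "astep g (Scan k \<eta> v i stk) =
    (if i < length (adj v) then
       let u = adj v ! i in
       if {v, u} \<in> active stk then
         ennreal q * g (Scan k \<eta> v (Suc i) stk) + ennreal (1 - q) *
           (if \<eta> u = 0 then g (Start k \<eta> u ((v, i) # stk))
            else if compat (\<eta> v) (\<eta> u) then g (Scan k \<eta> v (Suc i) stk)
            else g (Start k (\<eta>(v := 0)) v stk))
       else g (Scan k \<eta> v (Suc i) stk)
     else case stk of
         [] \<Rightarrow> if Suc k < length qs then g (Start (Suc k) \<eta> (qs ! Suc k) []) else g (Done \<eta>)
       | (w, j) # stk' \<Rightarrow>
           if compat (\<eta> w) (\<eta> v) then g (Scan k (\<eta>(v := 0)) w (Suc j) stk')
           else g (Start k (\<eta>(v := 0, w := 0)) w stk'))"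
| "astep g (Done \<eta>) = g (Done \<eta>)"

fun val :: "(nat \<Rightarrow> nat) \<Rightarrow> astate \<Rightarrow> real" where
  "val \<tau> (Start k \<eta> v stk) = free_val (ret_val \<tau> stk \<eta> v) v stk \<eta>"
| "val \<tau> (Scan k \<eta> v i stk) = scan_val (ret_val \<tau> stk (\<eta>(v := 0)) v) v i stk \<eta>"
| "val \<tau> (Done \<eta>) = target \<tau> \<eta>"

lemma val_nonneg: "0 \<le> val \<tau> a"
  by (cases a) (auto intro!: free_val_nonneg scan_val_nonneg target_nonneg ret_val_nonneg simp del: fun_upd_apply)

lemma linked_less: "linked k v stk \<Longrightarrow> v < n"
  using qs(2) adj_nth(1) by (cases stk) (auto simp: subset_iff dest: nth_mem)

lemma ennreal_mix:
  "0 \<le> p \<Longrightarrow> p \<le> 1 \<Longrightarrow> 0 \<le> x \<Longrightarrow> 0 \<le> y \<Longrightarrow>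
    ennreal p * ennreal x + ennreal (1 - p) * ennreal y = ennreal (p * x + (1 - p) * y)"
  by (simp add: ennreal_mult)

lemma next_query:
  assumes "invar (Scan k \<eta> v i [])" "Suc k < length qs"
  shows "\<eta> (qs ! Suc k) = 0" "qs ! Suc k < n" 
proof -
  have v: "v = qs ! k" "k < length qs"
    using assms by auto
  have "{w. \<eta> w \<noteq> 0} = set (take (Suc k) qs)"
    using assms(1) v by (auto simp: take_Suc_conv_app_nth)
  moreover have "qs ! Suc k \<notin> set (take (Suc k) qs)"
    using qs(1) assms(2) by (auto simp: in_set_conv_nth nth_eq_iff_index_eq)
  ultimately show "\<eta> (qs ! Suc k) = 0"
    by auto
  show "qs ! Suc k < n"
    using qs(2) assms(2) nth_mem by fastforce
qed

text \<open>The conditional output probability is a martingale: each kind of step is one of the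
  identities for \<open>free_val\<close>, \<open>scan_val\<close> and \<open>target\<close>.\<close>

lemma val_step:
  assumes "invar a" "\<nexists>\<eta>. a = Done \<eta>"
  shows "astep (\<lambda>a. ennreal (val \<tau> a)) a = ennreal (val \<tau> a)"
proof (cases a)
  case (Start k \<eta> v stk)
  with assms have inv: "good \<eta>" "\<eta> v = 0" "v < n"
    using linked_less by auto
  have upd: "\<eta>(v := c, v := 0) = \<eta>" for c
    using inv(2) by auto
  have p: "0 \<le> lam v 1 / (lam v 1 + lam v 2)" "lam v 1 / (lam v 1 + lam v 2) \<le> 1"
      "1 - lam v 1 / (lam v 1 + lam v 2) = lam v 2 / (lam v 1 + lam v 2)"
    using lam_nonneg[OF inv(3)] lam_pos[OF inv(3)] by (auto simp: field_simps)
  have "astep (\<lambda>a. ennreal (val \<tau> a)) a =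
      ennreal (lam v 1 / (lam v 1 + lam v 2) * val \<tau> (Scan k (\<eta>(v := 1)) v 0 stk)
        + (1 - lam v 1 / (lam v 1 + lam v 2)) * val \<tau> (Scan k (\<eta>(v := 2)) v 0 stk))"
    unfolding Start astep.simps by (rule ennreal_mix[OF p(1,2) val_nonneg val_nonneg])
  then show ?thesis
    unfolding p(3) Start val.simps upd free_val_start[OF inv(1,3,2)] .
next
  case (Scan k \<eta> v i stk)
  with assms have inv: "good \<eta>" "\<eta> v \<noteq> 0" "v < n" "distinct (v # map fst stk)" "invar (Scan k \<eta> v i stk)"
    using linked_less by auto
  let ?h = "ret_val \<tau> stk (\<eta>(v := 0)) v"
  show ?thesis
  proof (cases "i < length (adj v)")
    case i: True
    define u where "u = adj v ! i"
    show ?thesis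
    proof (cases "{v, u} \<in> active stk")
      case act: True
      show ?thesis
      proof (cases "\<eta> u = 0")
        case True
        then show ?thesis
          using scan_val_free[OF inv(1,3) i u_def act inv(2) True, of \<tau>] act i q
          by (simp add: Scan Let_def u_def[symmetric] ennreal_mix val_nonneg[of _ "Scan _ _ _ _ _", simplified]
              val_nonneg[of _ "Start _ _ _ _", simplified] del: ret_val.simps)
      next
        case False
        then show ?thesis
          using scan_val_pinned[OF inv(1,3) i u_def act inv(2) False, of ?h] act i q
          by (simp add: Scan Let_def u_def[symmetric] ennreal_mix val_nonneg[of _ "Scan _ _ _ _ _", simplified]
              val_nonneg[of _ "Start _ _ _ _", simplified] fun_upd_idem)
      qed
    next
      case False
      then show ?thesis
        using scan_val_skip[OF inv(3) i, of stk ?h \<eta>] i by (simp add: Scan u_def)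
    qed
  next
    case False
    then have fin: "val \<tau> a = ?h (\<eta> v)"
      using scan_val_done[OF inv(1), of v i ?h stk] by (simp add: Scan)
    show ?thesis
    proof (cases stk)
      case Nil
      have "\<eta>(v := \<eta> v) = \<eta>"
        by simp
      then have "val \<tau> a = target \<tau> \<eta>"
        using fin Nil by simp
      moreover have "astep (\<lambda>a. ennreal (val \<tau> a)) a = ennreal (target \<tau> \<eta>)"
      proof (cases "Suc k < length qs")
        case True
        then have "\<eta> (qs ! Suc k) = 0" "qs ! Suc k < n"
          using next_query inv(5) unfolding Nil by blast+
        then show ?thesis
          using False True free_val_root[OF inv(1), of "qs ! Suc k" \<tau>] by (simp add: Scan Nil)
      qed (use False in \<open>simp add: Scan Nil\<close>)
      ultimately show ?thesis
        by simp
    next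
      case (Cons f stk')
      obtain w j where f: "f = (w, j)"
        by (cases f)
      have "w \<noteq> v"
        using inv(4) Cons f by auto
      then show ?thesis
        using fin False by (simp add: Scan Cons f fun_upd_twist)
    qed
  qed
qed (use assms in auto)

section \<open>Expected number of steps\<close>

text \<open>
  \<open>K\<close> and \<open>R\<close> bound the expected number of steps of a recursive call and of a call for a
  query vertex. With \<open>k\<close> edges left, the current attempt needs a recursive call, and possibly a restart,
  with probability at most \<open>1 - q ^ k\<close>. This is at most \<open>2/5\<close> for \<open>k = \<Delta> - 1\<close> and \<open>1/2\<close> for \<open>k = \<Delta>\<close>,
  so the constants solve \<open>K = 2 + \<Delta> + (K + K) * (2/5)\<close> and \<open>R = 2 + \<Delta> + (K + R) * (1/2)\<close>.
\<close>

definition K :: real where "K = 5 * (2 + real \<Delta>)"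
definition R :: real where "R = 7 * (2 + real \<Delta>)"

definition cap :: "(nat \<times> nat) list \<Rightarrow> real" where
  "cap stk = (if stk = [] then R else K)"

text \<open>Debt of the frames below the top, each charged a full call: \<open>R\<close> for the
  bottom one, \<open>K\<close> for every other.\<close>

definition below :: "(nat \<times> nat) list \<Rightarrow> real" where
  "below stk = (if stk = [] then 0 else R + real (length stk - 1) * K)"

text \<open>Counts the remaining edges that may lead to a call. The edge to the caller is left out,
  since the caller withholds it.\<close>

definition branching :: "nat \<Rightarrow> nat \<Rightarrow> (nat \<times> nat) list \<Rightarrow> nat" where
  "branching v i stk = length (filter (\<lambda>u. stk = [] \<or> u \<noteq> fst (hd stk)) (drop i (adj v)))"

text \<open>The first 1 pays for the return; then comes one step per neighbour left. A failed coin
  is charged a call and a full continuation, \<open>K + cap stk\<close>.\<close>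

definition scan_cost :: "nat \<Rightarrow> nat \<Rightarrow> (nat \<times> nat) list \<Rightarrow> real" where
  "scan_cost v i stk = 1 + real (length (adj v) - i) + (K + cap stk) * (1 - q ^ branching v i stk)"

text \<open>The last summand in the running states pays for the queries not yet started.\<close>

fun pot :: "astate \<Rightarrow> real" where
  "pot (Start k \<eta> v stk) = cap stk + below stk + real (length qs - Suc k) * R"
| "pot (Scan k \<eta> v i stk) = scan_cost v i stk + below stk + real (length qs - Suc k) * R"
| "pot (Done \<eta>) = 0"

lemma K_R_pos: "0 < K" "0 < R"
  by (auto simp: K_def R_def)

lemma cap_pos: "0 < cap stk"
  using K_R_pos by (simp add: cap_def)

lemma below_nonneg: "0 \<le> below stk"
  using K_R_pos by (simp add: below_def)

lemma below_Cons: "below (f # stk) = cap stk + below stk"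
  by (cases stk) (auto simp: below_def cap_def algebra_simps)

lemma scan_cost_nonneg: "0 \<le> scan_cost v i stk"
  using q K_R_pos cap_pos[of stk] by (simp add: scan_cost_def power_le_one)

lemma pot_nonneg: "0 \<le> pot a"
  using K_R_pos less_imp_le[OF cap_pos] below_nonneg scan_cost_nonneg
  by (cases a) (simp_all add: less_imp_le)

text \<open>The caller is itself a neighbour of \<open>v\<close> and is not counted, which saves one
  edge in recursive calls.\<close>

lemma branching_le:
  assumes "linked k v stk"
  shows "branching v i stk \<le> (if stk = [] then \<Delta> else \<Delta> - 1)"
proof (cases stk)
  case Nil
  have "branching v i stk \<le> length (adj v)"
    using Nil by (simp add: branching_def)
  then show ?thesis
    using degree[OF linked_less[OF assms]] Nil by simp
next
  case (Cons f stk')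
  obtain w j where f: "f = (w, j)"
    by (cases f)
  have v: "v < n" and w: "w < n" "j < length (adj w)" "adj w ! j = v"
    using assms linked_less[OF assms] Cons f by auto
  have "{w, v} \<in> E"
    using adj_nth(3)[OF w(1,2)] w(3) by simp
  then have mem: "w \<in> set (adj v)"
    using adj(2)[OF v] by auto
  let ?P = "\<lambda>u. u \<noteq> w"
  have "branching v i stk \<le> length (filter ?P (drop i (adj v)))"
    by (simp add: branching_def Cons f)
  also have "\<dots> \<le> length (filter ?P (take i (adj v))) + length (filter ?P (drop i (adj v)))"
    by simp
  also have "\<dots> = length (filter ?P (adj v))"
    by (metis append_take_drop_id filter_append length_append)
  also have "\<dots> < length (adj v)"
    using mem by (intro length_filter_less) auto
  finally show ?thesis
    using degree[OF v] Cons by simp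
qed

text \<open>With \<open>i = 0\<close> the extra 1 pays for the start step. For other
  \<open>i\<close> it lets any continued scan be charged as a full call.\<close>

lemma scan_cost_le:
  assumes "linked k v stk"
  shows "1 + scan_cost v i stk \<le> cap stk"
proof -
  define d where "d = real (length (adj v) - i)"
  have deg: "d \<le> real \<Delta>"
    using degree[OF linked_less[OF assms]] by (simp add: d_def)
  show ?thesis
  proof (cases "stk = []")
    case True
    then have "q ^ \<Delta> \<le> q ^ branching v i stk"
      using branching_le[OF assms, of i] q by (intro power_decreasing) auto
    then have "1 - q ^ branching v i stk \<le> 1/2"
      using q(3) by linarith
    then have "(K + cap stk) * (1 - q ^ branching v i stk) \<le> (K + cap stk) * (1/2)"
      using K_R_pos cap_pos[of stk] by (intro mult_left_mono) auto
    moreover have "2 + d + (K + cap stk) * (1/2) \<le> cap stk"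
    proof -
      have c: "cap stk = R"
        using True by (simp add: cap_def)
      have KR: "(K + R) * (1/2) = 12 + 6 * real \<Delta>" "R = 14 + 7 * real \<Delta>"
        by (simp_all add: K_def R_def)
      show ?thesis
        unfolding c KR(1) using deg KR(2) by simp
    qed
    ultimately show ?thesis
      unfolding scan_cost_def d_def[symmetric] by linarith
  next
    case False
    then have "q ^ (\<Delta> - 1) \<le> q ^ branching v i stk"
      using branching_le[OF assms, of i] q by (intro power_decreasing) auto
    then have "1 - q ^ branching v i stk \<le> 2/5"
      using q(4) by linarith
    then have "(K + cap stk) * (1 - q ^ branching v i stk) \<le> (K + cap stk) * (2/5)"
      using K_R_pos cap_pos[of stk] by (intro mult_left_mono) auto
    moreover have "2 + d + (K + cap stk) * (2/5) \<le> cap stk"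
    proof -
      have c: "cap stk = K"
        using False by (simp add: cap_def)
      have KK: "(K + K) * (2/5) = 8 + 4 * real \<Delta>" "K = 10 + 5 * real \<Delta>"
        by (simp_all add: K_def)
      show ?thesis
        unfolding c KK(1) using deg KK(2) by simp
    qed
    ultimately show ?thesis
      unfolding scan_cost_def d_def[symmetric] by linarith
  qed
qed

text \<open>An active edge cannot lead to the caller, whose frame withholds the edge to
  \<open>v\<close>; hence it is counted, and passing it lowers the count by one.\<close>

lemma branching_Suc:
  assumes "linked k v stk" "i < length (adj v)"
  shows "branching v (Suc i) stk \<le> branching v i stk"
    and "{v, adj v ! i} \<in> active stk \<Longrightarrow> branching v i stk = Suc (branching v (Suc i) stk)"
proof -
  have drop: "drop i (adj v) = adj v ! i # drop (Suc i) (adj v)"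
    by (rule Cons_nth_drop_Suc[symmetric]) (rule assms(2))
  show "branching v (Suc i) stk \<le> branching v i stk"
    by (simp add: branching_def drop)
  assume act: "{v, adj v ! i} \<in> active stk"
  have "stk = [] \<or> adj v ! i \<noteq> fst (hd stk)"
  proof (cases stk)
    case (Cons f stk')
    obtain w j where f: "f = (w, j)"
      by (cases f)
    have "v \<in> set (drop j (adj w))"
      using assms(1) Cons f by (metis Cons_nth_drop_Suc linked.simps(2) list.set_intros(1))
    then have "{w, v} \<in> pending stk"
      by (auto simp: pending_def Cons f)
    then show ?thesis
      using act by (auto simp: active_def Cons f insert_commute)
  qed simp
  then show "branching v i stk = Suc (branching v (Suc i) stk)"
    by (simp add: branching_def drop)
qed

text \<open>The cost bound is a supermartingale that loses at least 1 per step.\<close>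

lemma pot_step:
  assumes "invar a" "\<nexists>\<eta>. a = Done \<eta>"
  shows "1 + astep (\<lambda>a. ennreal (pot a)) a \<le> ennreal (pot a)"
proof -
  have add1: "1 + ennreal x \<le> ennreal y" if "0 \<le> x" "1 + x \<le> y" for x y
    using that by (metis ennreal_1 ennreal_leI ennreal_plus zero_le_one)
  show ?thesis
  proof (cases a)
    case (Start k \<eta> v stk)
    with assms have l: "linked k v stk" and v: "v < n"
      using linked_less by auto
    have p: "0 \<le> lam v 1 / (lam v 1 + lam v 2)" "lam v 1 / (lam v 1 + lam v 2) \<le> 1"
      using lam_nonneg[OF v] lam_pos[OF v] by (auto simp: field_simps)
    have "astep (\<lambda>a. ennreal (pot a)) a = ennreal (pot (Scan k \<eta> v 0 stk))"
      unfolding Start astep.simps ennreal_mix[OF p pot_nonneg pot_nonneg] by (simp add: algebra_simps)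
    then show ?thesis
      using scan_cost_le[OF l, of 0] pot_nonneg[of "Scan k \<eta> v 0 stk"] by (simp only:) (rule add1, auto simp: Start)
  next
    case (Scan k \<eta> v i stk)
    with assms have l: "linked k v stk" and v: "v < n" and inv: "invar (Scan k \<eta> v i stk)"
      using linked_less by auto
    let ?t = "below stk + real (length qs - Suc k) * R"
    show ?thesis
    proof (cases "i < length (adj v)")
      case i: True
      define u where "u = adj v ! i"
      define r where "r = real (length (adj v) - Suc i)"
      have r: "real (length (adj v) - i) = 1 + r"
        using i by (simp add: r_def)
      show ?thesis
      proof (cases "{v, u} \<in> active stk")
        case act: True
        define B where "B = K + cap stk"
        define m where "m = branching v (Suc i) stk"
        have nxt: "scan_cost v (Suc i) stk = 1 + r + B * (1 - q ^ m)"
          by (simp add: scan_cost_def r_def B_def m_def)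
        have now: "scan_cost v i stk = 2 + r + B * (1 - q * q ^ m)"
          using branching_Suc(2)[OF l i] act by (simp add: scan_cost_def r B_def m_def u_def)
        define b where "b = (if \<eta> u = 0 then Start k \<eta> u ((v, i) # stk)
            else if compat (\<eta> v) (\<eta> u) then Scan k \<eta> v (Suc i) stk
            else Start k (\<eta>(v := 0)) v stk)"
        \<comment> \<open>A call costs \<open>K\<close> and leaves a continuation of at most
          \<open>cap stk\<close>; passing the edge or restarting costs at most
          \<open>cap stk\<close>.\<close>
        have b: "pot b \<le> B + ?t"
          using scan_cost_le[OF l, of "Suc i"] K_R_pos
          by (auto simp: b_def B_def below_Cons) (simp add: cap_def)
        have "astep (\<lambda>a. ennreal (pot a)) a = ennreal q * ennreal (pot (Scan k \<eta> v (Suc i) stk)) + ennreal (1 - q) * ennreal (pot b)"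
          using i act by (simp add: Scan Let_def b_def flip: u_def)
        also have "\<dots> = ennreal (q * pot (Scan k \<eta> v (Suc i) stk) + (1 - q) * pot b)"
          by (rule ennreal_mix) (use q pot_nonneg in \<open>auto simp del: pot.simps\<close>)
        finally have *: "astep (\<lambda>a. ennreal (pot a)) a = \<dots>" .
        have "(1 - q) * pot b \<le> (1 - q) * (B + ?t)"
          using b q by (intro mult_left_mono) auto
        moreover have "q * (1 + r) \<le> 1 + r"
          using q by (simp add: r_def mult_le_cancel_right1)
        \<comment> \<open>The coefficients of \<open>B\<close> match exactly:
          \<open>q * (1 - q ^ m) + (1 - q) = 1 - q * q ^ m\<close>.\<close>
        ultimately have "1 + (q * pot (Scan k \<eta> v (Suc i) stk) + (1 - q) * pot b) \<le> pot a"
          by (simp add: Scan nxt now algebra_simps)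
        moreover have "0 \<le> q * pot (Scan k \<eta> v (Suc i) stk) + (1 - q) * pot b"
          using q pot_nonneg[of "Scan k \<eta> v (Suc i) stk"] pot_nonneg[of b]
          by (intro add_nonneg_nonneg mult_nonneg_nonneg) (auto simp del: pot.simps)
        ultimately show ?thesis
          unfolding * by (intro add1)
      next
        \<comment> \<open>An absent edge is paid for by the neighbour count, and the number of
          possible calls does not grow.\<close>
        case False
        have "q ^ branching v i stk \<le> q ^ branching v (Suc i) stk"
          using branching_Suc(1)[OF l i] q by (intro power_decreasing) auto
        then have "(K + cap stk) * (1 - q ^ branching v (Suc i) stk) \<le> (K + cap stk) * (1 - q ^ branching v i stk)"
          using K_R_pos cap_pos[of stk] by (intro mult_left_mono) auto
        then have "1 + scan_cost v (Suc i) stk \<le> scan_cost v i stk"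
          by (simp add: scan_cost_def r flip: r_def)
        then show ?thesis
          using i False pot_nonneg[of "Scan k \<eta> v (Suc i) stk"] by (auto simp: Scan u_def intro!: add1)
      qed
    next
      case False
      have cost: "1 \<le> scan_cost v i stk"
        using q K_R_pos cap_pos[of stk] by (simp add: scan_cost_def power_le_one)
      show ?thesis
      proof (cases stk)
        case Nil
        then show ?thesis
          using False cost K_R_pos
          by (auto simp: Scan below_def cap_def algebra_simps intro!: add1)
      next
        case (Cons f stk')
        obtain w j where f: "f = (w, j)"
          by (cases f)
        have "linked k w stk'"
          using l Cons f by simp
        note cost_w = scan_cost_le[OF this, of "Suc j"]
        define b where "b = (if compat (\<eta> w) (\<eta> v) then Scan k (\<eta>(v := 0)) w (Suc j) stk'
          else Start k (\<eta>(v := 0, w := 0)) w stk')"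
        have "astep (\<lambda>a. ennreal (pot a)) a = ennreal (pot b)"
          using False by (simp add: Scan Cons f b_def)
        moreover have "1 + pot b \<le> pot a"
          using cost cost_w by (simp add: b_def Scan Cons f below_Cons)
        ultimately show ?thesis
          using add1[OF pot_nonneg] by simp
      qed
    qed
  qed (use assms in auto)
qed


section \<open>Representation of machine states in the store\<close>

text \<open>
  Each attempt at updating a vertex \<open>w\<close> gets a fresh block of \<open>n\<close> cells of the mark array, starting
  at \<open>B w\<close>; the cell of \<open>u\<close> in it tells whether the edge from \<open>w\<close> to \<open>u\<close> has been passed.
\<close>

definition blocks :: "nat \<Rightarrow> (nat \<Rightarrow> nat) \<Rightarrow> (nat \<Rightarrow> nat) \<Rightarrow> (nat \<Rightarrow> nat) \<Rightarrow> (nat \<times> nat) list \<Rightarrow> bool" where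
  "blocks c B T \<eta> stk \<longleftrightarrow> (\<forall>a\<ge>c. T a = 0) \<and>
    (\<forall>w. \<eta> w \<noteq> 0 \<longrightarrow> B w + n \<le> c \<and>
      (\<forall>x. \<eta> x \<noteq> 0 \<longrightarrow> x \<noteq> w \<longrightarrow> B w + n \<le> B x \<or> B x + n \<le> B w) \<and>
      (\<forall>u\<in>set (adj w). T (B w + u) \<noteq> 0 \<longleftrightarrow> (\<forall>i. (w, i) \<in> set stk \<longrightarrow> u \<in> set (take i (adj w)))))"

lemma adj_less: "w < n \<Longrightarrow> u \<in> set (adj w) \<Longrightarrow> u < n"
  using adj_nth(1) by (metis in_set_conv_nth)

text \<open>Cells from \<open>c\<close> on are still zero, so the new block records no passed edge,
  and all older blocks end before it.\<close>

lemma blocks_start: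
  assumes bl: "blocks c B T \<eta> stk" and v: "\<eta> v = 0" "v < n" "v \<notin> fst ` set stk"
  shows "blocks (c + n) (B(v := c)) T (\<eta>(v := d)) ((v, 0) # stk)"
proof -
  have zero: "T a = 0" if "c \<le> a" for a
    using bl that by (simp add: blocks_def)
  have old: "B w + n \<le> c"
    "\<And>x. \<eta> x \<noteq> 0 \<Longrightarrow> x \<noteq> w \<Longrightarrow> B w + n \<le> B x \<or> B x + n \<le> B w"
    "\<And>u. u \<in> set (adj w) \<Longrightarrow> T (B w + u) \<noteq> 0 \<longleftrightarrow> (\<forall>i. (w, i) \<in> set stk \<longrightarrow> u \<in> set (take i (adj w)))"
    if "\<eta> w \<noteq> 0" for w
    using bl that unfolding blocks_def by blast+
  have "(B(v := c)) w + n \<le> c + n \<and>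
      (\<forall>x. (\<eta>(v := d)) x \<noteq> 0 \<longrightarrow> x \<noteq> w \<longrightarrow>
        (B(v := c)) w + n \<le> (B(v := c)) x \<or> (B(v := c)) x + n \<le> (B(v := c)) w) \<and>
      (\<forall>u\<in>set (adj w). T ((B(v := c)) w + u) \<noteq> 0 \<longleftrightarrow>
        (\<forall>i. (w, i) \<in> set ((v, 0) # stk) \<longrightarrow> u \<in> set (take i (adj w))))"
    if w: "(\<eta>(v := d)) w \<noteq> 0" for w
  proof (cases "w = v")
    case True
    then show ?thesis
      using old(1) zero by (auto simp: trans_le_add1)
  next
    case False
    then have "\<eta> w \<noteq> 0"
      using w by simp
    from old[OF this] show ?thesis
      using False by auto
  qed
  then show ?thesis
    unfolding blocks_def using zero by simp
qed

text \<open>Blocks of different pinned vertices are disjoint, so the new mark is read for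
  \<open>v\<close> only.\<close>

lemma blocks_pass:
  assumes bl: "blocks c B T \<eta> ((v, i) # stk)" and "good \<eta>" "\<eta> v \<noteq> 0" "v \<notin> fst ` set stk" "i < length (adj v)"
  shows "blocks c B (T(B v + adj v ! i := Suc 0)) \<eta> ((v, Suc i) # stk)"
proof -
  have v: "v < n"
    using assms by (auto simp: good_def)
  have u: "adj v ! i < n"
    using adj_nth(1)[OF v assms(5)] .
  have "B v + n \<le> c"
    using bl assms(3) by (auto simp: blocks_def)
  then have fresh: "\<forall>a\<ge>c. (T(B v + adj v ! i := Suc 0)) a = 0"
    using bl u by (auto simp: blocks_def)
  have marks: "(T(B v + adj v ! i := Suc 0)) (B w + u) \<noteq> 0 \<longleftrightarrow>
      (\<forall>i'. (w, i') \<in> set ((v, Suc i) # stk) \<longrightarrow> u \<in> set (take i' (adj w)))"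
    if w: "\<eta> w \<noteq> 0" "u \<in> set (adj w)" for w u
  proof -
    have old: "T (B w + u) \<noteq> 0 \<longleftrightarrow>
        (\<forall>i'. (w, i') \<in> set ((v, i) # stk) \<longrightarrow> u \<in> set (take i' (adj w)))"
      using bl w by (auto simp: blocks_def)
    have "u < n"
      using w assms(2) adj_less by (auto simp: good_def)
    show ?thesis
    proof (cases "w = v")
      case True
      then have "(v, i') \<notin> set stk" for i'
        using assms(4) by (auto simp: rev_image_eqI)
      then show ?thesis
        using old True assms(5) by (auto simp: take_Suc_conv_app_nth)
    next
      case False
      then have "B v + n \<le> B w \<or> B w + n \<le> B v"
        using bl w(1) assms(3) by (auto simp: blocks_def)
      then have "B w + u \<noteq> B v + adj v ! i"
        using \<open>u < n\<close> \<open>adj v ! i < n\<close> by auto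
      then show ?thesis
        using old False by auto
    qed
  qed
  show ?thesis
    using bl fresh marks unfolding blocks_def by auto
qed

lemma blocks_drop:
  assumes "blocks c B T \<eta> ((v, i) # stk)"
  shows "blocks c B T (\<eta>(v := 0)) stk"
  using assms unfolding blocks_def by auto

text \<open>A finished scan has marked all neighbours, which is what is required of a pinned vertex
  that is no longer on the stack.\<close>

lemma blocks_root:
  assumes "blocks c B T \<eta> [(v, i)]" "length (adj v) \<le> i"
  shows "blocks c B T \<eta> []"
  using assms unfolding blocks_def by auto

text \<open>Registers 3, 5 and 6 are scratch and left unconstrained.\<close>

fun rep :: "store \<Rightarrow> astate \<Rightarrow> bool" where
  "rep s (Start k \<eta> v stk) \<longleftrightarrow> invar (Start k \<eta> v stk) \<and> nmem s 0 = \<eta> \<and> nmem s 1 0 = k \<and>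
     nmem s 1 1 = length stk \<and> nmem s 1 2 = 0 \<and> nmem s 2 (length stk) = v \<and>
     on_stack (nmem s 2) (nmem s 3) stk \<and> blocks (nmem s 1 4) (nmem s 4) (nmem s 5) \<eta> stk"
| "rep s (Scan k \<eta> v i stk) \<longleftrightarrow> invar (Scan k \<eta> v i stk) \<and> nmem s 0 = \<eta> \<and> nmem s 1 0 = k \<and>
     nmem s 1 1 = length stk \<and> nmem s 1 2 = 1 \<and>
     on_stack (nmem s 2) (nmem s 3) ((v, i) # stk) \<and>
     blocks (nmem s 1 4) (nmem s 4) (nmem s 5) \<eta> ((v, i) # stk)"
| "rep s (Done \<eta>) \<longleftrightarrow> invar (Done \<eta>) \<and> nmem s 0 = \<eta> \<and> nmem s 1 0 = length qs"

lemma rep_scratch: "3 \<le> r \<Longrightarrow> r \<noteq> 4 \<Longrightarrow> rep (nupdate 1 r x s) a = rep s a"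
  by (cases a) auto

section \<open>Preservation of the invariant and of the representation\<close>

lemma inv_StartD:
  assumes "invar (Start k \<eta> v stk)"
  shows "v < n" "good \<eta>" "\<eta> v = 0" "v \<notin> fst ` set stk" "v \<notin> set (take k qs)"
proof -
  show "\<eta> v = 0"
    using assms by simp
  then have "v \<notin> {w. \<eta> w \<noteq> 0}"
    by simp
  also have "{w. \<eta> w \<noteq> 0} = set (take k qs) \<union> fst ` set stk"
    using assms by simp
  finally show "v \<notin> fst ` set stk" "v \<notin> set (take k qs)"
    by blast+
qed (use assms linked_less in auto)

lemma inv_ScanD:
  assumes "invar (Scan k \<eta> v i stk)"
  shows "v < n" "good \<eta>" "\<eta> v \<noteq> 0" "v \<notin> fst ` set stk" "i \<le> length (adj v)"
proof -
  have "v \<in> set (take k qs) \<union> insert v (fst ` set stk)"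
    by simp
  also have "\<dots> = {w. \<eta> w \<noteq> 0}"
    using assms by simp
  finally show "\<eta> v \<noteq> 0"
    by simp
qed (use assms linked_less in auto)

lemma inv_start:
  assumes inv: "invar (Start k \<eta> v stk)" and d: "d \<in> {1, 2}" "0 < lam v d"
  shows "invar (Scan k (\<eta>(v := d)) v 0 stk)"
proof -
  have "{w. (\<eta>(v := d)) w \<noteq> 0} = insert v {w. \<eta> w \<noteq> 0}"
    using d(1) by auto
  also have "{w. \<eta> w \<noteq> 0} = set (take k qs) \<union> fst ` set stk"
    using inv by simp
  finally have "{w. (\<eta>(v := d)) w \<noteq> 0} = set (take k qs) \<union> insert v (fst ` set stk)"
    by blast
  then show ?thesis
    using inv inv_StartD[OF inv] good_upd[of \<eta> v d] d by simp
qed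

lemma inv_pass:
  "invar (Scan k \<eta> v i stk) \<Longrightarrow> i < length (adj v) \<Longrightarrow> invar (Scan k \<eta> v (Suc i) stk)"
  by simp

lemma inv_restart:
  assumes inv: "invar (Scan k \<eta> v i stk)"
  shows "invar (Start k (\<eta>(v := 0)) v stk)"
proof -
  have "{w. (\<eta>(v := 0)) w \<noteq> 0} = {w. \<eta> w \<noteq> 0} - {v}"
    by auto
  also have "{w. \<eta> w \<noteq> 0} = set (take k qs) \<union> insert v (fst ` set stk)"
    using inv by simp
  also have "\<dots> - {v} = set (take k qs) \<union> fst ` set stk"
    using inv by auto
  finally show ?thesis
    using inv by (simp add: good_upd_0)
qed

lemma inv_push:
  assumes inv: "invar (Scan k \<eta> v i stk)" and i: "i < length (adj v)" "\<eta> (adj v ! i) = 0"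
  shows "invar (Start k \<eta> (adj v ! i) ((v, i) # stk))"
  using assms inv_ScanD(1)[OF inv] by simp

lemma inv_pop:
  assumes inv: "invar (Scan k \<eta> v i ((w, j) # stk))"
  shows "invar (Scan k (\<eta>(v := 0)) w j stk)"
  using inv_restart[OF inv] by simp

lemma inv_next:
  assumes inv: "invar (Scan k \<eta> v i [])" and k: "Suc k < length qs"
  shows "invar (Start (Suc k) \<eta> (qs ! Suc k) [])"
proof -
  have "set (take (Suc k) qs) = set (take k qs) \<union> {v}"
    using inv by (simp add: take_Suc_conv_app_nth)
  then show ?thesis
    using inv next_query[OF inv k] k by simp
qed

lemma inv_done:
  assumes inv: "invar (Scan k \<eta> v i [])" and k: "\<not> Suc k < length qs"
  shows "invar (Done \<eta>)" "Suc k = length qs"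
proof -
  show k': "Suc k = length qs"
    using inv k by simp
  have "set (take (Suc k) qs) = set (take k qs) \<union> {v}"
    using inv by (simp add: take_Suc_conv_app_nth)
  then show "invar (Done \<eta>)"
    using inv k' by simp
qed

text \<open>This and the following rules describe the new store only by contents that
  \<open>rep\<close> reads, so that scratch writes are free.\<close>

lemma rep_start:
  assumes s: "rep s (Start k \<eta> v stk)" and d: "d \<in> {1, 2}" "0 < lam v d"
    and s': "nmem s' 0 = (nmem s 0)(v := d)" "nmem s' 1 0 = nmem s 1 0" "nmem s' 1 1 = nmem s 1 1"
      "nmem s' 1 2 = 1" "nmem s' 1 4 = nmem s 1 4 + n" "nmem s' 2 = nmem s 2"
      "nmem s' 3 = (nmem s 3)(length stk := 0)" "nmem s' 4 = (nmem s 4)(v := nmem s 1 4)"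
      "nmem s' 5 = nmem s 5"
  shows "rep s' (Scan k (\<eta>(v := d)) v 0 stk)"
proof -
  have inv: "invar (Start k \<eta> v stk)"
    using s by (simp del: invar.simps)
  have "blocks (nmem s 1 4 + n) ((nmem s 4)(v := nmem s 1 4)) (nmem s 5) (\<eta>(v := d)) ((v, 0) # stk)"
    using s by (intro blocks_start inv_StartD[OF inv]) (simp del: invar.simps)
  then show ?thesis
    using s s' inv_start[OF inv d] by (simp add: on_stack_upd del: invar.simps)
qed

lemma rep_pass:
  assumes s: "rep s (Scan k \<eta> v i stk)" and i: "i < length (adj v)"
    and s': "nmem s' 0 = nmem s 0" "nmem s' 1 0 = nmem s 1 0" "nmem s' 1 1 = nmem s 1 1"
      "nmem s' 1 2 = 1" "nmem s' 1 4 = nmem s 1 4" "nmem s' 2 = nmem s 2"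
      "nmem s' 3 = (nmem s 3)(length stk := Suc i)" "nmem s' 4 = nmem s 4"
      "nmem s' 5 = (nmem s 5)(nmem s 4 v + adj v ! i := 1)"
  shows "rep s' (Scan k \<eta> v (Suc i) stk)"
proof -
  have inv: "invar (Scan k \<eta> v i stk)"
    using s by (simp del: invar.simps)
  have "blocks (nmem s 1 4) (nmem s 4) ((nmem s 5)(nmem s 4 v + adj v ! i := Suc 0)) \<eta> ((v, Suc i) # stk)"
    using s i by (intro blocks_pass inv_ScanD[OF inv]) (simp_all del: invar.simps)
  then show ?thesis
    using s s' inv_pass[OF inv i] by (simp add: on_stack_upd del: invar.simps)
qed

lemma rep_restart:
  assumes s: "rep s (Scan k \<eta> v i stk)"
    and s': "nmem s' 0 = (nmem s 0)(v := 0)" "nmem s' 1 0 = nmem s 1 0" "nmem s' 1 1 = nmem s 1 1"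
      "nmem s' 1 2 = 0" "nmem s' 1 4 = nmem s 1 4" "nmem s' 2 = nmem s 2"
      "nmem s' 3 = nmem s 3" "nmem s' 4 = nmem s 4" "nmem s' 5 = nmem s 5"
  shows "rep s' (Start k (\<eta>(v := 0)) v stk)"
  using s s' inv_restart[of k \<eta> v i stk] blocks_drop[of "nmem s 1 4" "nmem s 4" "nmem s 5" \<eta> v i stk]
  by (simp del: invar.simps)

lemma rep_push:
  assumes s: "rep s (Scan k \<eta> v i stk)" and i: "i < length (adj v)" "\<eta> (adj v ! i) = 0"
    and s': "nmem s' 0 = nmem s 0" "nmem s' 1 0 = nmem s 1 0" "nmem s' 1 1 = Suc (nmem s 1 1)"
      "nmem s' 1 2 = 0" "nmem s' 1 4 = nmem s 1 4" "nmem s' 2 = (nmem s 2)(Suc (length stk) := adj v ! i)"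
      "nmem s' 3 = nmem s 3" "nmem s' 4 = nmem s 4" "nmem s' 5 = nmem s 5"
  shows "rep s' (Start k \<eta> (adj v ! i) ((v, i) # stk))"
  using s s' i inv_push[of k \<eta> v i stk] by (simp add: on_stack_upd del: invar.simps)

text \<open>
  When a frame returns, its vertex is freed; the frame below then reads as one that is still
  scanning the same edge.
\<close>

lemma rep_pop:
  assumes s: "rep s (Scan k \<eta> v i ((w, j) # stk))"
    and s': "nmem s' 0 = (nmem s 0)(v := 0)" "nmem s' 1 0 = nmem s 1 0" "nmem s' 1 1 = nmem s 1 1 - 1"
      "nmem s' 1 2 = 1" "nmem s' 1 4 = nmem s 1 4" "nmem s' 2 = nmem s 2"
      "nmem s' 3 = nmem s 3" "nmem s' 4 = nmem s 4" "nmem s' 5 = nmem s 5"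
  shows "rep s' (Scan k (\<eta>(v := 0)) w j stk)"
  using s s' inv_pop[of k \<eta> v i w j stk]
    blocks_drop[of "nmem s 1 4" "nmem s 4" "nmem s 5" \<eta> v i "(w, j) # stk"]
  by (simp del: invar.simps)

lemma rep_next:
  assumes s: "rep s (Scan k \<eta> v i [])" and i: "length (adj v) \<le> i" and k: "Suc k < length qs"
    and s': "nmem s' 0 = nmem s 0" "nmem s' 1 0 = Suc k" "nmem s' 1 1 = nmem s 1 1"
      "nmem s' 1 2 = 0" "nmem s' 1 4 = nmem s 1 4" "nmem s' 2 0 = qs ! Suc k"
      "nmem s' 4 = nmem s 4" "nmem s' 5 = nmem s 5"
  shows "rep s' (Start (Suc k) \<eta> (qs ! Suc k) [])"
  using s s' inv_next[OF _ k, of \<eta> v i] blocks_root[OF _ i, of "nmem s 1 4" "nmem s 4" "nmem s 5" \<eta>]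
  by (simp del: invar.simps)

lemma rep_done:
  assumes s: "rep s (Scan k \<eta> v i [])" and k: "\<not> Suc k < length qs"
    and s': "nmem s' 0 = nmem s 0" "nmem s' 1 0 = Suc k"
  shows "rep s' (Done \<eta>)"
  using s s' inv_done[OF _ k, of \<eta> v i] by (simp del: invar.simps)

section \<open>Initial state and total output mass\<close>

lemma linked_query: "linked k v stk \<Longrightarrow> k < length qs"
  by (induction stk arbitrary: v) auto

lemma Ext_empty: "Ext (\<lambda>_. 0) = configs {..<n}"
  by (simp add: Ext_def)

lemma sum_target: "(\<Sum>\<tau>\<in>configs (set qs). target \<tau> (\<lambda>_. 0)) = 1"
proof -
  have "(\<Sum>\<tau>\<in>configs (set qs). \<Sum>\<sigma> | \<sigma> \<in> Ext (\<lambda>_. 0) \<and> restrict \<sigma> (set qs) = \<tau>. wt E \<sigma>) = Z E (\<lambda>_. 0)"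
    unfolding Z_def
  proof (rule sum.group)
    show "finite (configs (set qs))"
      by (simp add: configs_def finite_PiE)
    show "(\<lambda>\<sigma>. restrict \<sigma> (set qs)) ` Ext (\<lambda>_. 0) \<subseteq> configs (set qs)"
      using qs(2) by (auto simp: Ext_empty configs_def PiE_iff)
  qed simp
  moreover have "Z E (\<lambda>_. 0) > 0"
    by (rule Z_pos) (simp add: good_def)
  ultimately show ?thesis
    by (simp add: target_def flip: sum_divide_distrib)
qed

lemma target_outside:
  assumes "\<tau> \<notin> configs (set qs)"
  shows "target \<tau> (\<lambda>_. 0) = 0"
proof -
  have "{\<sigma> \<in> Ext (\<lambda>_. 0). restrict \<sigma> (set qs) = \<tau>} = {}"
    using assms qs(2) by (auto simp: Ext_empty configs_def PiE_iff)
  then show ?thesis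
    unfolding target_def by (simp only: sum.empty div_0)
qed

definition initial :: astate where
  "initial = (if qs = [] then Done (\<lambda>_. 0) else Start 0 (\<lambda>_. 0) (qs ! 0) [])"

lemma initial_empty: "qs = [] \<Longrightarrow> initial = Done (\<lambda>_. 0)"
  unfolding initial_def by (rule if_P)

lemma initial_nonempty: "qs \<noteq> [] \<Longrightarrow> initial = Start 0 (\<lambda>_. 0) (qs ! 0) []"
  unfolding initial_def by (rule if_not_P)

lemma inv_initial: "invar initial"
proof (cases "qs = []")
  case True
  show ?thesis
    unfolding initial_empty[OF True] invar.simps by (simp add: good_def True)
next
  case False
  then show ?thesis
    unfolding initial_nonempty[OF False] by (simp add: good_def)
qed

lemma val_initial: "val \<tau> initial = target \<tau> (\<lambda>_. 0)"
proof (cases "qs = []")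
  case True
  show ?thesis
    unfolding initial_empty[OF True] by simp
next
  case False
  then have "qs ! 0 < n"
    using qs(2) nth_mem by fastforce
  then show ?thesis
    unfolding initial_nonempty[OF False]
    using free_val_root[of "\<lambda>_. 0" "qs ! 0" \<tau>] by (simp add: good_def)
qed

lemma pot_initial: "pot initial = real (length qs) * R"
proof (cases "qs = []")
  case True
  show ?thesis
    unfolding initial_empty[OF True] pot.simps using True by simp
next
  case False
  then have "real (length qs - Suc 0) = real (length qs) - 1"
    by (cases qs) auto
  then show ?thesis
    unfolding initial_nonempty[OF False] by (simp add: cap_def below_def algebra_simps)
qed

end

section \<open>Ising inputs and simulation of the machine by the program\<close>

text \<open>On spins 1 and 2, compatible pairs are those with the larger edge factor; at
  \<open>\<beta> = 1\<close> both factors agree and every pair counts.\<close>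

definition spin_compat :: "real \<Rightarrow> nat \<Rightarrow> nat \<Rightarrow> bool" where
  "spin_compat \<beta> a b \<longleftrightarrow> (if \<beta> < 1 then a \<noteq> b else 1 < \<beta> \<longrightarrow> a = b)"

lemma spin_compat_iff:
  assumes "a \<in> {1, 2}" "b \<in> {1, 2}"
  shows "spin_compat \<beta> a b \<longleftrightarrow> \<not> ising_matrix \<beta> a b < ising_matrix \<beta> a (3 - b)"
  using assms by (auto simp: spin_compat_def ising_matrix_def)

locale ising_input =
  ising_sampler "num_verts M" "edges M" "ext_field M" q "spin_compat \<beta>" adj qs \<Delta>
  for M :: spin_system and \<beta> q :: real and adj :: "nat \<Rightarrow> nat list" and qs :: "nat list" and \<Delta> :: nat +
  assumes interaction: "\<And>e a b. e \<in> edges M \<Longrightarrow> a \<in> {1, 2} \<Longrightarrow> b \<in> {1, 2} \<Longrightarrow>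
      interaction M e a b = ising_matrix \<beta> a b"
    and \<beta>_pos: "0 < \<beta>"
    and q_eq: "q = min \<beta> (1 / \<beta>)"
begin

definition I :: input where "I = \<lparr>model = M, nbrs = adj, queries = qs\<rparr>"

lemma I_simps [simp]: "model I = M" "nbrs I = adj" "queries I = qs"
  by (simp_all add: I_def)

text \<open>Infimum over the representations, so that every represented state gives an upper bound;
  it is infinite on stores that represent no state.\<close>

definition lift :: "(astate \<Rightarrow> ennreal) \<Rightarrow> store \<Rightarrow> ennreal" where
  "lift g s = (INF a\<in>{a. rep s a}. g a)"

lemma lift_le: "rep s a \<Longrightarrow> lift g s \<le> g a"
  by (auto simp: lift_def intro: INF_lower)

lemma rep_Start_nval:
  assumes "rep s (Start k \<eta> v stk)"
  shows "nval I s (reg 1) = length stk" "nval I s (reg 2) = 0" "nval I s TopV = v"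
  using assms by (simp_all add: com_defs)

lemma rep_Scan_nval:
  assumes "rep s (Scan k \<eta> v i stk)"
  shows "nval I s (reg 0) = k" "nval I s (reg 1) = length stk" "nval I s (reg 2) = 1"
    "nval I s TopV = v" "nval I s TopI = i"
    "nval I s TopU = (if i < length (adj v) then adj v ! i else num_verts M)"
  using assms by (simp_all add: com_defs Let_def)

lemma bval_compat_test:
  assumes "nval I s A \<in> {1, 2}" "nval I s B \<in> {1, 2}" "{nval I s V, nval I s U} \<in> edges M"
  shows "bval I s (compat_test V U A B) \<longleftrightarrow> spin_compat \<beta> (nval I s A) (nval I s B)"
proof -
  have "3 - nval I s B \<in> {1, 2}"
    using assms(2) by auto
  then show ?thesis
    using assms spin_compat_iff[OF assms(1,2)] by (simp add: compat_test_def interaction)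
qed

lemma wp_start:
  assumes s: "rep s (Start k \<eta> v stk)"
  shows "wp I start_com (lift g) s \<le> astep g (Start k \<eta> v stk)"
proof -
  let ?l = "ext_field M v"
  let ?p = "?l 1 / (?l 1 + ?l 2)"
  have inv: "invar (Start k \<eta> v stk)"
    using s by (simp del: invar.simps)
  have v: "v < num_verts M"
    using inv_StartD[OF inv] by simp
  have p: "0 \<le> ?p" "?p \<le> 1" "1 - ?p = ?l 2 / (?l 1 + ?l 2)"
    using lam_nonneg[OF v] lam_pos[OF v] by (auto simp: field_simps)
  define st where "st d = nupdate 1 2 1 (nupdate 3 (length stk) 0 (nupdate 1 4 (nmem s 1 4 + num_verts M)
     (nupdate 4 v (nmem s 1 4) (nupdate 0 v d (nupdate 1 3 (2 - d) s)))))" for d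
  have "wp I start_com (lift g) s = ennreal ?p * lift g (st 1) + ennreal (1 - ?p) * lift g (st 2)"
    using s p(1,2) by (simp add: start_com_def st_def coin_def com_defs)
  also have "\<dots> \<le> ennreal ?p * g (Scan k (\<eta>(v := 1)) v 0 stk) + ennreal (1 - ?p) * g (Scan k (\<eta>(v := 2)) v 0 stk)"
  proof (intro add_mono)
    have *: "lift g (st d) \<le> g (Scan k (\<eta>(v := d)) v 0 stk)" if "d \<in> {1, 2}" "0 < ?l d" for d
      by (rule lift_le, rule rep_start[OF s that]) (simp_all add: st_def)
    \<comment> \<open>A spin of zero field has probability 0, and multiplication by 0 absorbs even
      an infinite value of \<open>lift\<close>.\<close>
    show "ennreal ?p * lift g (st 1) \<le> ennreal ?p * g (Scan k (\<eta>(v := 1)) v 0 stk)"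
      using *[of 1] lam_nonneg[OF v, of 1] by (cases "?l 1 = 0") (auto intro!: mult_left_mono)
    show "ennreal (1 - ?p) * lift g (st 2) \<le> ennreal (1 - ?p) * g (Scan k (\<eta>(v := 2)) v 0 stk)"
      unfolding p(3) using *[of 2] lam_nonneg[OF v, of 2] by (cases "?l 2 = 0") (auto intro!: mult_left_mono)
  qed
  finally show ?thesis
    by simp
qed

lemma wp_pass:
  assumes s: "rep s (Scan k \<eta> v i stk)" and i: "i < length (adj v)"
  shows "wp I pass_com (lift g) s \<le> g (Scan k \<eta> v (Suc i) stk)"
proof -
  define st where "st = nupdate 3 (length stk) (Suc i) (nupdate 5 (nmem s 4 v + adj v ! i) 1 s)"
  have "wp I pass_com (lift g) s = lift g st"
    using s i by (simp add: com_defs st_def Let_def del: invar.simps)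
  also have "\<dots> \<le> g (Scan k \<eta> v (Suc i) stk)"
    using s by (intro lift_le rep_pass[OF s i]) (simp_all add: st_def)
  finally show ?thesis .
qed

lemma wp_restart:
  assumes s: "rep s (Scan k \<eta> v i stk)"
  shows "wp I restart_com (lift g) s \<le> g (Start k (\<eta>(v := 0)) v stk)"
proof -
  define st where "st = nupdate 1 2 0 (nupdate 0 v 0 s)"
  have "wp I restart_com (lift g) s = lift g st"
    using s by (simp add: com_defs st_def del: invar.simps)
  also have "\<dots> \<le> g (Start k (\<eta>(v := 0)) v stk)"
    using s by (intro lift_le rep_restart[OF s]) (simp_all add: st_def)
  finally show ?thesis .
qed

lemma wp_push:
  assumes s: "rep s (Scan k \<eta> v i stk)" and i: "i < length (adj v)" "\<eta> (adj v ! i) = 0"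
  shows "wp I push_com (lift g) s \<le> g (Start k \<eta> (adj v ! i) ((v, i) # stk))"
proof -
  define st where "st = nupdate 1 2 0 (nupdate 1 1 (Suc (length stk)) (nupdate 2 (Suc (length stk)) (adj v ! i) s))"
  have "wp I push_com (lift g) s = lift g st"
    using s i by (simp add: com_defs st_def Let_def del: invar.simps)
  also have "\<dots> \<le> g (Start k \<eta> (adj v ! i) ((v, i) # stk))"
    using s by (intro lift_le rep_push[OF s i]) (simp_all add: st_def)
  finally show ?thesis .
qed

lemma wp_coin:
  assumes s: "rep s (Scan k \<eta> v i stk)" and i: "i < length (adj v)"
  shows "wp I coin_com f s = ennreal q * f (nupdate 1 3 1 s) + ennreal (1 - q) * f (nupdate 1 3 0 s)"
proof -
  have "v < num_verts M"
    using inv_ScanD[of k \<eta> v i stk] s by (simp del: invar.simps)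
  then have E: "{v, adj v ! i} \<in> edges M"
    by (rule adj_nth(3)) (rule i)
  have "coin (ising_matrix \<beta> 1 1 / ising_matrix \<beta> 1 2) = q" if "\<beta> < 1"
    using that \<beta>_pos mult_le_one[of \<beta> \<beta>] by (simp add: ising_matrix_def coin_def q_eq min_def field_simps)
  moreover have "coin (ising_matrix \<beta> 1 2 / ising_matrix \<beta> 1 1) = q" if "\<not> \<beta> < 1"
  proof -
    have "1 / \<beta> \<le> 1" "1 / \<beta> \<le> \<beta>"
      using that order_trans[of "1 / \<beta>" 1 \<beta>] by simp_all
    then show ?thesis
      using \<beta>_pos by (simp add: ising_matrix_def coin_def q_eq)
  qed
  moreover have "ising_matrix \<beta> 1 1 < ising_matrix \<beta> 1 2 \<longleftrightarrow> \<beta> < 1"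
    by (simp add: ising_matrix_def)
  ultimately show ?thesis
    using interaction[OF E] rep_Scan_nval[OF s] i by (simp add: coin_com_def Let_def)
qed

lemma pending_iff:
  "{v, u} \<in> pending stk \<longleftrightarrow> (\<exists>i. (v, i) \<in> set stk \<and> u \<in> set (drop i (adj v))) \<or>
    (\<exists>i. (u, i) \<in> set stk \<and> v \<in> set (drop i (adj u)))"
proof -
  have "{v, u} \<in> pending stk \<longleftrightarrow>
      (\<exists>w i x. (w, i) \<in> set stk \<and> x \<in> set (drop i (adj w)) \<and> (v = w \<and> u = x \<or> v = x \<and> u = w))"
    unfolding pending_def doubleton_eq_iff[symmetric] by blast
  then show ?thesis
    by blast
qed

lemma not_on_stack: "v \<notin> fst ` set stk \<Longrightarrow> (v, i) \<notin> set stk"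
  by (metis fst_conv image_eqI)

text \<open>As \<open>v\<close> is not among the lower frames, only a frame of its neighbour can
  withhold the edge. This is the condition that \<open>blocks\<close> ties to the mark of
  \<open>v\<close> in the neighbour's block.\<close>

lemma pinned_active_iff:
  assumes inv: "invar (Scan k \<eta> v i stk)" and i: "i < length (adj v)" and u: "\<eta> (adj v ! i) \<noteq> 0"
  shows "{v, adj v ! i} \<in> active stk \<longleftrightarrow>
    (\<forall>i'. (adj v ! i, i') \<in> set ((v, i) # stk) \<longrightarrow> v \<in> set (take i' (adj (adj v ! i))))"
proof -
  let ?u = "adj v ! i"
  have v: "v < num_verts M" "v \<notin> fst ` set stk"
    using inv_ScanD[OF inv] by auto
  have U: "?u < num_verts M" "?u \<noteq> v" and E: "{v, ?u} \<in> edges M"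
    using adj_nth[OF v(1) i] by auto
  have mem: "v \<in> set (adj ?u)"
    using adj(2)[OF U(1)] E by simp
  have split: "v \<in> set (drop i' (adj ?u)) \<longleftrightarrow> v \<notin> set (take i' (adj ?u))" for i'
  proof -
    have "set (take i' (adj ?u)) \<inter> set (drop i' (adj ?u)) = {}"
      by (rule set_take_disj_set_drop_if_distinct[OF adj(1)[OF U(1)] order_refl])
    moreover have "set (adj ?u) = set (take i' (adj ?u)) \<union> set (drop i' (adj ?u))"
      by (metis append_take_drop_id set_append)
    ultimately show ?thesis
      using mem by blast
  qed
  have "{v, ?u} \<in> pending stk \<longleftrightarrow> (\<exists>i'. (?u, i') \<in> set stk \<and> v \<in> set (drop i' (adj ?u)))"
    using not_on_stack[OF v(2)] by (simp add: pending_iff)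
  then show ?thesis
    using E U(2) by (auto simp: active_def split)
qed

lemma wp_probe:
  assumes s: "rep s (Scan k \<eta> v i stk)" and i: "i < length (adj v)"
  shows "wp I probe_com (lift g) s \<le> astep g (Scan k \<eta> v i stk)"
proof -
  let ?u = "adj v ! i"
  have inv: "invar (Scan k \<eta> v i stk)" and \<eta>: "nmem s 0 = \<eta>"
    using s by (simp_all del: invar.simps)
  note iv = inv_ScanD[OF inv]
  have U: "?u < num_verts M" "?u \<noteq> v" and E: "{v, ?u} \<in> edges M"
    using adj_nth[OF iv(1) i] by auto
  have mem: "v \<in> set (adj ?u)"
    using adj(2)[OF U(1)] E by simp
  have spin: "\<eta> w \<noteq> 0 \<Longrightarrow> \<eta> w \<in> {1, 2}" for w
    using iv(2) by (auto simp: good_def)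
  have mark: "nmem s 5 (nmem s 4 ?u + v) \<noteq> 0 \<longleftrightarrow> {v, ?u} \<in> active stk" if "\<eta> ?u \<noteq> 0"
    using s that mem pinned_active_iff[OF inv i that] by (simp add: blocks_def del: invar.simps)
  \<comment> \<open>A free neighbour is not on the stack, so no lower frame withholds the edge to
    it.\<close>
  have nactive: "{v, ?u} \<in> active stk" if "\<eta> ?u = 0"
  proof -
    have "?u \<notin> {w. \<eta> w \<noteq> 0}"
      using that by simp
    also have "{w. \<eta> w \<noteq> 0} = set (take k qs) \<union> insert v (fst ` set stk)"
      using inv by simp
    finally have "?u \<notin> fst ` set stk"
      by blast
    then have "{v, ?u} \<notin> pending stk"
      using not_on_stack[OF iv(4)] by (simp add: pending_iff not_on_stack)
    then show ?thesis
      using E by (simp add: active_def)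
  qed
  have nv: "nval I s TopV = v" "nval I s TopU = ?u"
    using rep_Scan_nval[OF s] i by auto
  show ?thesis
  proof (cases "{v, ?u} \<in> active stk")
    case False
    then have "\<eta> ?u \<noteq> 0" "nmem s 5 (nmem s 4 ?u + v) = 0"
      using nactive mark by auto
    then have "wp I probe_com (lift g) s = wp I pass_com (lift g) s"
      by (simp add: probe_com_def positive_def nv \<eta>)
    also have "\<dots> \<le> g (Scan k \<eta> v (Suc i) stk)"
      by (rule wp_pass[OF s i])
    finally show ?thesis
      using i False by simp
  next
    case True
    let ?s1 = "nupdate 1 3 1 s" and ?s2 = "nupdate 1 3 0 s"
    define c where "c = Cond (positive (NLoad 0 TopU))
            (Cond (compat_test TopV TopU (NLoad 0 TopV) (NLoad 0 TopU)) pass_com restart_com)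
            push_com"
    have s1: "rep ?s1 (Scan k \<eta> v i stk)" and s2: "rep ?s2 (Scan k \<eta> v i stk)"
      using s by (simp_all only: rep_scratch)
    have "\<not> (\<eta> ?u \<noteq> 0 \<and> nmem s 5 (nmem s 4 ?u + v) = 0)"
      using mark True by blast
    then have "wp I probe_com (lift g) s =
        wp I coin_com (wp I (Cond (positive (reg 3)) pass_com c) (lift g)) s"
      by (auto simp: probe_com_def positive_def nv \<eta> c_def)
    also have "\<dots> = ennreal q * wp I pass_com (lift g) ?s1 + ennreal (1 - q) * wp I c (lift g) ?s2"
      by (simp add: wp_coin[OF s i] positive_def reg_def)
    also have "\<dots> \<le> ennreal q * g (Scan k \<eta> v (Suc i) stk) + ennreal (1 - q) *
           (if \<eta> ?u = 0 then g (Start k \<eta> ?u ((v, i) # stk))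
            else if spin_compat \<beta> (\<eta> v) (\<eta> ?u) then g (Scan k \<eta> v (Suc i) stk)
            else g (Start k (\<eta>(v := 0)) v stk))"
    proof (intro add_mono mult_left_mono)
      show "wp I pass_com (lift g) ?s1 \<le> g (Scan k \<eta> v (Suc i) stk)"
        by (rule wp_pass[OF s1 i])
      have nv2: "nval I ?s2 TopV = v" "nval I ?s2 TopU = ?u" "nmem ?s2 0 = \<eta>"
        using rep_Scan_nval[OF s2] i \<eta> by auto
      show "wp I c (lift g) ?s2 \<le> (if \<eta> ?u = 0 then g (Start k \<eta> ?u ((v, i) # stk))
            else if spin_compat \<beta> (\<eta> v) (\<eta> ?u) then g (Scan k \<eta> v (Suc i) stk)
            else g (Start k (\<eta>(v := 0)) v stk))"
      proof (cases "\<eta> ?u = 0")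
        case True
        then show ?thesis
          using wp_push[OF s2 i True] nv2 by (simp add: c_def positive_def)
      next
        case False
        have "bval I ?s2 (compat_test TopV TopU (NLoad 0 TopV) (NLoad 0 TopU)) \<longleftrightarrow> spin_compat \<beta> (\<eta> v) (\<eta> ?u)"
          using spin[OF False] spin[OF iv(3)] E nv2 by (subst bval_compat_test) auto
        then show ?thesis
          using False wp_pass[OF s2 i, of g] wp_restart[OF s2, of g] nv2 by (simp add: c_def positive_def)
      qed
    qed auto
    finally show ?thesis
      using i True by (simp add: Let_def)
  qed
qed

lemma wp_return:
  assumes s: "rep s (Scan k \<eta> v i stk)" and i: "\<not> i < length (adj v)"
  shows "wp I return_com (lift g) s \<le> astep g (Scan k \<eta> v i stk)"
proof -
  have inv: "invar (Scan k \<eta> v i stk)" and \<eta>: "nmem s 0 = \<eta>"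
    using s by (simp_all del: invar.simps)
  note iv = inv_ScanD[OF inv]
  show ?thesis
  proof (cases stk)
    case Nil
    \<comment> \<open>Past the last query \<open>QueryAt\<close> yields \<open>num_verts M\<close>;
      the state is then \<open>Done\<close> and the guard fails.\<close>
    define st where "st = nupdate 1 2 0 (nupdate 2 0 (if Suc k < length qs then qs ! Suc k else num_verts M) (nupdate 1 0 (Suc k) s))"
    have s0: "rep s (Scan k \<eta> v i [])"
      using s unfolding Nil .
    have "wp I return_com (lift g) s = lift g st"
      using s0 by (simp add: com_defs st_def Let_def del: invar.simps)
    also have "\<dots> \<le> (if Suc k < length qs then g (Start (Suc k) \<eta> (qs ! Suc k) []) else g (Done \<eta>))"
    proof (cases "Suc k < length qs")
      case True
      have "rep st (Start (Suc k) \<eta> (qs ! Suc k) [])"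
        by (rule rep_next[OF s0]) (use s0 i True in \<open>simp_all add: st_def del: invar.simps\<close>)
      then show ?thesis
        using True by (simp add: lift_le del: rep.simps)
    next
      case False
      have "rep st (Done \<eta>)"
        by (rule rep_done[OF s0 False]) (simp_all add: st_def)
      then show ?thesis
        using False by (simp add: lift_le del: rep.simps)
    qed
    finally show ?thesis
      using i Nil by simp
  next
    case (Cons f stk')
    obtain w j where f: "f = (w, j)"
      by (cases f)
    have s0: "rep s (Scan k \<eta> v i ((w, j) # stk'))"
      using s unfolding Cons f .
    have inv0: "invar (Scan k \<eta> v i ((w, j) # stk'))"
      using inv unfolding Cons f .
    define st where "st = nupdate 1 1 (length stk') (nupdate 0 v 0 (nupdate 1 6 (\<eta> v) (nupdate 1 5 v s)))"
    have rep: "rep st (Scan k (\<eta>(v := 0)) w j stk')"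
      by (rule rep_pop[OF s0]) (use s0 in \<open>simp_all add: st_def del: invar.simps\<close>)
    note nv = rep_Scan_nval[OF rep]
    have j: "w < num_verts M" "j < length (adj w)" "adj w ! j = v"
      using inv0 by auto
    then have E: "{w, v} \<in> edges M"
      using adj_nth(3) by blast
    have w: "\<eta> w \<noteq> 0" "w \<noteq> v"
      using inv_ScanD(3)[OF inv_pop[OF inv0]] by (auto split: if_splits)
    have spin: "\<eta> x \<noteq> 0 \<Longrightarrow> \<eta> x \<in> {1, 2}" for x
      using iv(2) by (auto simp: good_def)
    have st: "nmem st 0 = \<eta>(v := 0)" "nmem st 1 5 = v" "nmem st 1 6 = \<eta> v"
      using \<eta> by (simp_all add: st_def)
    have "wp I return_com (lift g) s =
        wp I (Cond (compat_test TopV (reg 5) (NLoad 0 TopV) (reg 6)) pass_com restart_com) (lift g) st"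
      using s0 by (simp add: return_com_def reg_def TopV_def positive_def st_def del: invar.simps)
    moreover have "bval I st (compat_test TopV (reg 5) (NLoad 0 TopV) (reg 6)) \<longleftrightarrow> spin_compat \<beta> (\<eta> w) (\<eta> v)"
      using spin[OF iv(3)] spin[OF w(1)] w(2) E nv(4) st by (subst bval_compat_test) (auto simp: reg_def)
    ultimately show ?thesis
      using wp_pass[OF rep j(2), of g] wp_restart[OF rep, of g] i Cons f by simp
  qed
qed

lemma wp_body:
  assumes "rep s a" "\<nexists>\<eta>. a = Done \<eta>"
  shows "wp I body (lift g) s \<le> astep g a"
proof (cases a)
  case (Start k \<eta> v stk)
  then have s: "rep s (Start k \<eta> v stk)"
    using assms by simp
  have "wp I body (lift g) s = wp I start_com (lift g) s"
    using rep_Start_nval[OF s] by (simp add: body_def positive_def)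
  then show ?thesis
    using wp_start[OF s] Start by simp
next
  case (Scan k \<eta> v i stk)
  then have s: "rep s (Scan k \<eta> v i stk)"
    using assms by simp
  have "v < num_verts M"
    using s inv_ScanD[of k \<eta> v i stk] by (simp del: invar.simps)
  then have "adj v ! i < num_verts M" if "i < length (adj v)"
    using adj_nth(1) that by blast
  then have "wp I body (lift g) s = wp I (if i < length (adj v) then probe_com else return_com) (lift g) s"
    using rep_Scan_nval[OF s] by (auto simp: body_def positive_def)
  then show ?thesis
    using wp_probe[OF s] wp_return[OF s] Scan by (auto split: if_splits simp del: astep.simps)
qed (use assms in auto)


section \<open>Correctness and running time\<close>

abbreviation guard :: bexp where
  "guard \<equiv> NLess (reg 0) QuerySize"

definition first :: store where
  "first = nupdate 2 0 (nval I init_store (QueryAt (NConst 0))) init_store"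

lemma rep_first: "rep first initial"
proof -
  have blocks: "blocks 0 (\<lambda>_. 0) (\<lambda>_. 0) (\<lambda>_. 0) []"
    by (simp add: blocks_def)
  have f: "nmem first 0 = (\<lambda>_. 0)" "nmem first 1 = (\<lambda>_. 0)" "nmem first 4 = (\<lambda>_. 0)" "nmem first 5 = (\<lambda>_. 0)"
    by (simp_all add: first_def init_store_def)
  show ?thesis
  proof (cases "qs = []")
    case True
    have "invar (Done (\<lambda>_. 0))"
      using inv_initial unfolding initial_empty[OF True] .
    moreover have "nmem first 1 0 = length qs"
      unfolding f using True by simp
    ultimately show ?thesis
      unfolding initial_empty[OF True] rep.simps using f(1) by blast
  next
    case False
    then have "nmem first 2 0 = qs ! 0"
      by (simp add: first_def init_store_def)
    then show ?thesis
      using blocks f inv_initial unfolding initial_nonempty[OF False] by (simp del: invar.simps)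
  qed
qed

lemma rep_inv: "rep s a \<Longrightarrow> invar a"
  by (cases a) (auto simp del: invar.simps)

lemma rep_guard: "rep s a \<Longrightarrow> bval I s guard \<longleftrightarrow> (\<nexists>\<eta>. a = Done \<eta>)"
  using linked_query by (cases a) (auto simp: reg_def)

text \<open>A step bound holds for every state that the store represents, hence for the infimum. It
  is used with \<open>x = 1\<close> for the cost and \<open>x = 0\<close> for the output.\<close>

lemma lift_step:
  assumes g: "\<And>a. invar a \<Longrightarrow> \<nexists>\<eta>. a = Done \<eta> \<Longrightarrow> x + astep g a \<le> g a" and s: "bval I s guard"
  shows "x + wp I body (lift g) s \<le> lift g s"
  unfolding lift_def[of g s]
proof (rule INF_greatest)
  fix a assume "a \<in> {a. rep s a}"
  then have a: "rep s a"
    by simp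
  then have nd: "\<nexists>\<eta>. a = Done \<eta>"
    using rep_guard s by blast
  have "x + wp I body (lift g) s \<le> x + astep g a"
    by (intro add_left_mono wp_body a nd)
  also have "\<dots> \<le> g a"
    by (intro g rep_inv[OF a] nd)
  finally show "x + wp I body (lift g) s \<le> g a" .
qed

abbreviation loop :: "(store \<times> nat) spmf" where
  "loop \<equiv> exec I (While guard body) first"

lemma run_sampler: "run sampler I = map_spmf (\<lambda>(s, t). (s, Suc t)) loop"
  by (simp add: run_def sampler_def exec_simps first_def map_spmf_conv_bind_spmf case_prod_unfold)

lemma lossless_loop: "lossless_spmf loop"
proof (rule while_lossless[OF loopfree_body])
  show "1 + wp I body (lift (\<lambda>a. ennreal (pot a))) s \<le> lift (\<lambda>a. ennreal (pot a)) s" if "bval I s guard" for s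
    by (rule lift_step[OF pot_step that])
  show "lift (\<lambda>a. ennreal (pot a)) first < \<top>"
    using lift_le[OF rep_first, of "\<lambda>a. ennreal (pot a)"] by (rule le_less_trans) simp
qed

text \<open>An iteration takes at most 20 units for the body and 1 for the guard; the final 1 is the
  failing guard.\<close>

lemma loop_time: "(\<integral>\<^sup>+ (s, t). of_nat t \<partial>measure_spmf loop) \<le> 21 * ennreal (pot initial) + 1"
proof -
  let ?\<Phi> = "lift (\<lambda>a. ennreal (pot a))"
  have "(\<integral>\<^sup>+ (s, t). 0 + 1 * of_nat t \<partial>measure_spmf loop) \<le> 21 * ?\<Phi> first + 1"
  proof (rule while_upper_bound[OF loopfree_body time_bound_body])
    fix s assume "bval I s guard"
    have "1 * of_nat (20 + 1) + wp I body (\<lambda>s. 21 * ?\<Phi> s + 1) s = 21 * (1 + wp I body ?\<Phi> s) + 1"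
      by (simp add: wp_add[OF loopfree_body] wp_cmult[OF loopfree_body] wp_const[OF loopfree_body] distrib_left add_ac)
    also have "\<dots> \<le> 21 * ?\<Phi> s + 1"
      by (intro add_right_mono mult_left_mono lift_step[OF pot_step] \<open>bval I s guard\<close>) auto
    finally show "1 * of_nat (20 + 1) + wp I body (\<lambda>s. 21 * ?\<Phi> s + 1) s \<le> 21 * ?\<Phi> s + 1" .
  qed simp
  also have "\<dots> \<le> 21 * ennreal (pot initial) + 1"
    by (intro add_right_mono mult_left_mono lift_le rep_first) auto
  finally show ?thesis
    by simp
qed

text \<open>At exit all query vertices are pinned, so \<open>target\<close> is 1 on the stores that
  output \<open>\<tau>\<close>; the loop rule with \<open>\<kappa> = 0\<close> carries this back to
  the start.\<close>

lemma loop_output: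
  "(\<integral>\<^sup>+ (s, t). indicator {s. restrict (nmem s 0) (set qs) = \<tau>} s \<partial>measure_spmf loop)
    \<le> ennreal (target \<tau> (\<lambda>_. 0))"
proof -
  let ?f = "indicator {s. restrict (nmem s 0) (set qs) = \<tau>} :: store \<Rightarrow> ennreal"
  let ?\<Psi> = "lift (\<lambda>a. ennreal (val \<tau> a))"
  have "(\<integral>\<^sup>+ (s, t). ?f s + 0 * of_nat t \<partial>measure_spmf loop) \<le> ?\<Psi> first"
  proof (rule while_upper_bound[OF loopfree_body time_bound_body])
    fix s assume s: "bval I s guard"
    have step: "0 + astep (\<lambda>a. ennreal (val \<tau> a)) a \<le> ennreal (val \<tau> a)"
      if "invar a" "\<nexists>\<eta>. a = Done \<eta>" for a
      using val_step[OF that, of \<tau>] by simp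
    have "0 + wp I body ?\<Psi> s \<le> ?\<Psi> s"
      by (rule lift_step[OF step s])
    then show "0 * of_nat (20 + 1) + wp I body ?\<Psi> s \<le> ?\<Psi> s"
      by simp
  next
    fix s assume s: "\<not> bval I s guard"
    have "?f s \<le> ennreal (val \<tau> a)" if a: "rep s a" for a
    proof -
      obtain \<eta> where \<eta>: "a = Done \<eta>"
        using rep_guard[OF a] s by blast
      then have *: "good \<eta>" "{w. \<eta> w \<noteq> 0} = set qs" "nmem s 0 = \<eta>"
        using a by auto
      show ?thesis
      proof (cases "restrict \<eta> (set qs) = \<tau>")
        case True
        then have "target \<tau> \<eta> = 1"
          using * by (intro target_final) auto
        then show ?thesis
          by (simp add: \<eta> indicator_def)
      qed (simp add: * indicator_def)
    qed
    then show "?f s + 0 \<le> ?\<Psi> s"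
      unfolding lift_def by (auto intro!: INF_greatest)
  qed
  also have "\<dots> \<le> ennreal (val \<tau> initial)"
    by (rule lift_le[OF rep_first])
  finally show ?thesis
    by (simp add: val_initial)
qed

lemma sampled_le: "spmf (sampled_config sampler I) \<tau> \<le> target \<tau> (\<lambda>_. 0)"
proof -
  have "ennreal (spmf (sampled_config sampler I) \<tau>) =
      (\<integral>\<^sup>+ x. indicator ((\<lambda>(s, t). restrict (nmem s 0) (set qs)) -` {\<tau>}) x \<partial>measure_spmf loop)"
    by (simp add: sampled_config_def run_sampler spmf.map_comp o_def case_prod_unfold ennreal_spmf_map)
  also have "\<dots> = (\<integral>\<^sup>+ (s, t). indicator {s. restrict (nmem s 0) (set qs) = \<tau>} s \<partial>measure_spmf loop)"
    by (intro nn_integral_cong) (auto simp: indicator_def)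
  also have "\<dots> \<le> ennreal (target \<tau> (\<lambda>_. 0))"
    by (rule loop_output)
  finally show ?thesis
    by (simp add: target_nonneg)
qed

text \<open>The upper bounds sum to one and the total mass is one, so they are all attained.\<close>

lemma sampled_eq:
  assumes \<tau>: "\<tau> \<in> configs (set qs)"
  shows "spmf (sampled_config sampler I) \<tau> = target \<tau> (\<lambda>_. 0)"
proof -
  let ?p = "sampled_config sampler I"
  let ?C = "configs (set qs)"
  have fin: "finite ?C"
    by (simp add: configs_def finite_PiE)
  have "lossless_spmf ?p"
    using lossless_loop by (simp add: sampled_config_def run_sampler)
  \<comment> \<open>Outside \<open>?C\<close> the upper bound \<open>target\<close> is 0, so no mass
    escapes the sum.\<close>
  moreover have "set_spmf ?p \<subseteq> ?C"
  proof
    fix x assume "x \<in> set_spmf ?p"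
    then have "0 < spmf ?p x"
      by (simp add: in_set_spmf_iff_spmf less_le)
    then show "x \<in> ?C"
      using sampled_le[of x] target_outside[of x] by fastforce
  qed
  then have "measure (measure_spmf ?p) ?C = weight_spmf ?p"
    by (intro measure_spmf.finite_measure_eq_AE) (auto simp: space_measure_spmf)
  ultimately have "(\<Sum>x\<in>?C. spmf ?p x) = 1"
    using measure_spmf.finite_measure_eq_sum_singleton[of ?C ?p] fin
    by (simp add: lossless_spmf_def spmf_conv_measure_spmf)
  then have "(\<Sum>x\<in>?C. target x (\<lambda>_. 0) - spmf ?p x) = 0"
    by (simp add: sum_subtractf sum_target)
  then have "\<forall>x\<in>?C. target x (\<lambda>_. 0) - spmf ?p x = 0"
    using fin sampled_le by (subst (asm) sum_nonneg_eq_0_iff) auto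
  then show ?thesis
    using \<tau> by simp
qed

lemma expected_time_sampler:
  "expected_time sampler I \<le> ennreal (21 * real (length qs) * R + 2)"
proof -
  have "expected_time sampler I = (\<integral>\<^sup>+ (s, t). 1 + of_nat t \<partial>measure_spmf loop)"
    by (simp add: expected_time_def run_sampler case_prod_unfold o_def)
  also have "\<dots> = 1 + (\<integral>\<^sup>+ (s, t). of_nat t \<partial>measure_spmf loop)"
    using lossless_loop
    by (simp add: case_prod_unfold nn_integral_add measure_spmf.emeasure_eq_measure space_measure_spmf lossless_spmf_def)
  also have "\<dots> \<le> 1 + (21 * ennreal (pot initial) + 1)"
    by (intro add_left_mono loop_time)
  also have "\<dots> = 21 * ennreal (pot initial) + 2"
    by (metis add.assoc add.commute one_add_one)
  also have "\<dots> = ennreal (21 * real (length qs) * R + 2)"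
    using K_R_pos by (simp add: pot_initial ennreal_mult mult.assoc)
  finally show ?thesis .
qed

section \<open>Identification with the Gibbs marginal\<close>

lemma ising_matrix_fac: "ising_matrix \<beta> a b = max 1 \<beta> * fac a b"
proof -
  consider "\<beta> < 1" | "\<beta> = 1" | "1 < \<beta>"
    by linarith
  then show ?thesis
  proof cases
    case 1
    then have "q = \<beta>"
      using \<beta>_pos mult_le_one[of \<beta> \<beta>] by (simp add: q_eq min_def field_simps)
    then show ?thesis
      unfolding fac_def spin_compat_def ising_matrix_def using 1 by simp
  next
    case 2
    then have "q = 1"
      by (simp add: q_eq)
    then show ?thesis
      unfolding fac_def spin_compat_def ising_matrix_def using 2 by simp
  next
    case 3
    then have "1 / \<beta> < \<beta>"
      using less_trans[of "1 / \<beta>" 1 \<beta>] by simp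
    then have "q = 1 / \<beta>"
      by (simp add: q_eq)
    then show ?thesis
      unfolding fac_def spin_compat_def ising_matrix_def using 3 by simp
  qed
qed

lemma weight_eq:
  assumes "\<sigma> \<in> configs (verts M)"
  shows "weight M \<sigma> = max 1 \<beta> ^ card (edges M) * wt (edges M) \<sigma>"
proof -
  have "interaction M e (\<sigma> (Min e)) (\<sigma> (Max e)) = max 1 \<beta> * fac (\<sigma> (Min e)) (\<sigma> (Max e))" if e: "e \<in> edges M" for e
  proof -
    obtain u v where uv: "u < num_verts M" "v < num_verts M" "e = {u, v}"
      using edgesE[OF e] by blast
    then have "Min e \<in> {u, v}" "Max e \<in> {u, v}"
      using Min_in[of e] Max_in[of e] by auto
    then have "\<sigma> (Min e) \<in> {1, 2}" "\<sigma> (Max e) \<in> {1, 2}"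
      using assms uv by (auto simp: configs_def verts_def PiE_iff)
    then show ?thesis
      using interaction[OF e] ising_matrix_fac by simp
  qed
  then show ?thesis
    by (simp add: weight_def wt_def verts_def prod.distrib)
qed

text \<open>Normalizing each edge factor by \<open>max 1 \<beta>\<close> scales all weights by the
  same constant, which cancels.\<close>

lemma target_eq_marginal: "target \<tau> (\<lambda>_. 0) = marginal M (set qs) \<tau>"
proof -
  let ?c = "max 1 \<beta> ^ card (edges M)"
  have c: "?c \<noteq> 0"
    by (simp add: max_def)
  have pf: "partition_function M = ?c * Z (edges M) (\<lambda>_. 0)"
    unfolding partition_function_def Z_def sum_distrib_left Ext_empty
    by (rule sum.cong) (auto simp: weight_eq verts_def)
  have "marginal M (set qs) \<tau> =
      (\<Sum>\<sigma> | \<sigma> \<in> configs (verts M) \<and> restrict \<sigma> (set qs) = \<tau>. ?c * wt (edges M) \<sigma>) / (?c * Z (edges M) (\<lambda>_. 0))"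
    unfolding marginal_def gibbs_def sum_divide_distrib
    by (rule sum.cong) (auto simp: weight_eq pf)
  also have "\<dots> = target \<tau> (\<lambda>_. 0)"
    unfolding target_def Ext_empty verts_def sum_distrib_left[symmetric]
    by (rule mult_divide_mult_cancel_left[OF c])
  finally show ?thesis ..
qed

end

section \<open>Numerical bounds and the instantiation\<close>

lemma exp_half_le: "exp (1 / 2 :: real) \<le> 5 / 3"
proof (rule power2_le_imp_le)
  have "exp (1 / 2 :: real) ^ 2 = exp 1"
    by (simp flip: exp_of_nat_mult)
  also have "\<dots> \<le> (5 / 3) ^ 2"
    using e_less_272 by (simp add: power2_eq_square)
  finally show "exp (1 / 2 :: real) ^ 2 \<le> (5 / 3) ^ 2" .
qed simp

text \<open>Bernoulli's inequality gives the first bound. For the power \<open>d - 1\<close> it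
  would only give values tending to 1/2, where the cost recursion degenerates; instead
  \<open>1 / r = 1 + 1 / (2 * d - 1)\<close> is compared with the exponential, and
  \<open>exp (1/2) \<le> 5/3\<close>.\<close>

lemma activity_power_bounds:
  fixes q :: real
  assumes d: "1 \<le> d" and q: "(real d - 1/2) / real d \<le> q"
  shows "1/2 \<le> q ^ d" "3/5 \<le> q ^ (d - 1)"
proof -
  define r where "r = (real d - 1/2) / real d"
  have r: "0 < r" "r \<le> q"
    using d q by (auto simp: r_def)
  have r_eq: "r = 1 + (- 1 / (2 * real d))"
    using d by (simp add: r_def field_simps)
  have "1/2 = 1 + real d * (- 1 / (2 * real d))"
    using d by simp
  also have "\<dots> \<le> r ^ d"
    unfolding r_eq using d by (intro Bernoulli_inequality) (simp add: field_simps)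
  also have "\<dots> \<le> q ^ d"
    using r by (intro power_mono) auto
  finally show "1/2 \<le> q ^ d" .
  have "inverse r = 1 + 1 / (2 * real d - 1)"
    using d by (simp add: r_def field_simps)
  also have "\<dots> \<le> exp (1 / (2 * real d - 1))"
    by (rule exp_ge_add_one_self)
  finally have "inverse r ^ (d - 1) \<le> exp (1 / (2 * real d - 1)) ^ (d - 1)"
    using r by (intro power_mono) auto
  also have "\<dots> = exp (real (d - 1) * (1 / (2 * real d - 1)))"
    by (rule exp_of_nat_mult[symmetric])
  also have "\<dots> \<le> exp (1 / 2)"
    using d by (simp add: field_simps)
  also have "\<dots> \<le> 5 / 3"
    by (rule exp_half_le)
  finally have "3/5 \<le> r ^ (d - 1)"
    using r by (simp add: power_inverse field_simps)
  also have "\<dots> \<le> q ^ (d - 1)"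
    using r by (intro power_mono) auto
  finally show "3/5 \<le> q ^ (d - 1)" .
qed

lemma length_adjacency_le:
  assumes "simple_graph M" "adjacency_lists M adj" "v \<in> verts M"
  shows "length (adj v) \<le> max_degree M"
proof -
  have adj: "distinct (adj v)" "set (adj v) = {u. {u, v} \<in> edges M}"
    using assms by (auto simp: adjacency_lists_def)
  have fin: "finite (edges M)"
    by (rule finite_subset[of _ "Pow (verts M)"])
      (use assms(1) in \<open>auto simp: simple_graph_def verts_def\<close>)
  have "length (adj v) = card ((\<lambda>u. {u, v}) ` set (adj v))"
    using adj(1) by (subst card_image) (auto simp: inj_on_def doubleton_eq_iff distinct_card)
  also have "\<dots> \<le> vertex_degree M v"
    unfolding vertex_degree_def using fin adj(2) by (intro card_mono) auto
  also have "\<dots> \<le> max_degree M"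
    unfolding max_degree_def using assms(3) by (intro Max_ge) (auto simp: verts_def)
  finally show ?thesis .
qed

text \<open>A field vanishing at both spins would make every weight, and so the partition function,
  zero.\<close>

lemma ising_model_field_pos:
  assumes "ising_model M \<beta>" "v \<in> verts M"
  shows "0 < ext_field M v 1 + ext_field M v 2"
proof (rule ccontr)
  assume "\<not> ?thesis"
  moreover have "0 \<le> ext_field M v 1" "0 \<le> ext_field M v 2"
    using assms by (auto simp: ising_model_def)
  ultimately have zero: "ext_field M v 1 = 0" "ext_field M v 2 = 0"
    by linarith+
  have "weight M \<sigma> = 0" if "\<sigma> \<in> configs (verts M)" for \<sigma>
  proof -
    have "\<sigma> v \<in> {1, 2}"
      using that assms(2) by (auto simp: configs_def PiE_iff)
    then have "ext_field M v (\<sigma> v) = 0"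
      using zero by auto
    moreover have "finite (verts M)"
      by (simp add: verts_def)
    ultimately show ?thesis
      using assms(2) by (auto simp: weight_def prod_zero_iff)
  qed
  then have "partition_function M = 0"
    by (simp add: partition_function_def)
  then show False
    using assms(1) by (simp add: ising_model_def)
qed

lemma ising_input_intro:
  assumes M: "ising_model M \<beta>" and d: "1 \<le> max_degree M"
    and \<beta>: "\<beta> \<in> {(real (max_degree M) - 1/2) / real (max_degree M) <..< real (max_degree M) / (real (max_degree M) - 1/2)}"
    and adj: "adjacency_lists M adj" and qs: "distinct qs" "set qs \<subseteq> verts M"
  shows "ising_input M \<beta> (min \<beta> (1 / \<beta>)) adj qs (max_degree M)"
proof
  let ?q = "min \<beta> (1 / \<beta>)" and ?d = "max_degree M"
  have pos: "0 < \<beta>" and graph: "simple_graph M"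
    using M by (auto simp: ising_model_def)
  \<comment> \<open>The upper end of the activity range, inverted, bounds \<open>1 / \<beta>\<close>
    from below.\<close>
  have "(real ?d - 1/2) / real ?d \<le> 1 / \<beta>"
  proof -
    have "\<beta> * (real ?d - 1/2) < real ?d"
      using \<beta> d by (simp add: pos_less_divide_eq)
    then show ?thesis
      using pos d by (simp add: field_simps)
  qed
  then have *: "(real ?d - 1/2) / real ?d \<le> ?q"
    using \<beta> by simp
  show "1/2 \<le> ?q ^ ?d" "3/5 \<le> ?q ^ (?d - 1)"
    using activity_power_bounds[OF d *] by auto
  show "0 < \<beta>" "0 < ?q"
    using pos by auto
  show "?q \<le> 1"
    using pos by (auto simp: min_le_iff_disj)
  show "spin_compat \<beta> a b = spin_compat \<beta> b a" for a b
    by (auto simp: spin_compat_def)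
  show "\<exists>u<num_verts M. \<exists>v<num_verts M. u \<noteq> v \<and> e = {u, v}" if "e \<in> edges M" for e
    using graph that unfolding simple_graph_def verts_def by blast
  show "interaction M e a b = ising_matrix \<beta> a b" if "e \<in> edges M" "a \<in> {1, 2}" "b \<in> {1, 2}" for e a b
    using M that unfolding ising_model_def by blast
  fix v assume "v < num_verts M"
  then have v: "v \<in> verts M"
    by (simp add: verts_def)
  show "distinct (adj v)" "set (adj v) = {u. {u, v} \<in> edges M}"
    using adj v by (auto simp: adjacency_lists_def)
  show "0 < ext_field M v 1 + ext_field M v 2"
    by (rule ising_model_field_pos[OF M v])
  show "length (adj v) \<le> ?d"
    by (rule length_adjacency_le[OF graph adj v])
  show "0 \<le> ext_field M v c" if "c \<in> {1, 2}" for c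
    using M v that by (auto simp: ising_model_def)
qed (use qs in \<open>auto simp: verts_def\<close>)

theorem corollary1p3:
  shows "\<exists>P :: com. \<exists>C :: real. \<forall>M \<beta> \<Delta> adj \<Lambda> qs.
    ising_model M \<beta> \<longrightarrow>
    max_degree M = \<Delta> \<longrightarrow> 1 \<le> \<Delta> \<longrightarrow>
    \<beta> \<in> {(real \<Delta> - 1/2) / real \<Delta> <..< real \<Delta> / (real \<Delta> - 1/2)} \<longrightarrow>
    adjacency_lists M adj \<longrightarrow>
    \<Lambda> \<subseteq> verts M \<longrightarrow> distinct qs \<longrightarrow> set qs = \<Lambda> \<longrightarrow>
    (let I = \<lparr>model = M, nbrs = adj, queries = qs\<rparr> in
      lossless_spmf (run P I) \<and>
      (\<forall>\<tau>\<in>configs \<Lambda>. spmf (sampled_config P I) \<tau> = marginal M \<Lambda> \<tau>) \<and>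
      expected_time P I \<le> ennreal (C * real \<Delta> * real (max 1 (card \<Lambda>))))"
proof (intro exI allI impI)
  fix M \<beta> \<Delta> adj \<Lambda> and qs :: "nat list"
  assume M: "ising_model M \<beta>" and \<Delta>: "max_degree M = \<Delta>" "1 \<le> \<Delta>"
    and \<beta>: "\<beta> \<in> {(real \<Delta> - 1/2) / real \<Delta> <..< real \<Delta> / (real \<Delta> - 1/2)}"
    and adj: "adjacency_lists M adj" and \<Lambda>: "\<Lambda> \<subseteq> verts M" and query: "distinct qs" "set qs = \<Lambda>"
  interpret ising_input M \<beta> "min \<beta> (1 / \<beta>)" adj qs \<Delta>
    using ising_input_intro[OF M _ _ adj query(1)] \<Delta> \<beta> \<Lambda> query(2) by blast
  \<comment> \<open>The maximum with 1 absorbs the constant overhead when there are no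
    queries.\<close>
  define m where "m = real (max 1 (card \<Lambda>))"
  have m: "real (length qs) \<le> m" "1 \<le> m"
    using distinct_card[OF query(1)] unfolding query(2) by (auto simp: m_def)
  have d: "1 \<le> real \<Delta>"
    using \<Delta> by simp
  have R: "R \<le> 21 * real \<Delta>"
    using d by (simp add: R_def)
  have "21 * (real (length qs) * R) \<le> 21 * (m * (21 * real \<Delta>))"
    using m R K_R_pos by (intro mult_left_mono mult_mono) auto
  moreover have "1 \<le> real \<Delta> * m"
    using mult_mono[OF d m(2)] d by simp
  \<comment> \<open>\<open>R = 7 * (2 + \<Delta>)\<close> is at most \<open>21 * \<Delta>\<close>,
    and \<open>443 = 21 * 21 + 2\<close>.\<close>
  ultimately have bound: "21 * real (length qs) * R + 2 \<le> 443 * real \<Delta> * m"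
    by (simp add: algebra_simps)
  have "expected_time sampler I \<le> ennreal (443 * real \<Delta> * m)"
    by (rule order_trans[OF expected_time_sampler ennreal_leI[OF bound]])
  moreover have "lossless_spmf (run sampler I)"
    using lossless_loop by (simp add: run_sampler)
  moreover have "\<forall>\<tau>\<in>configs \<Lambda>. spmf (sampled_config sampler I) \<tau> = marginal M \<Lambda> \<tau>"
    using sampled_eq target_eq_marginal query(2) by simp
  ultimately show "let I = \<lparr>model = M, nbrs = adj, queries = qs\<rparr> in
      lossless_spmf (run sampler I) \<and>
      (\<forall>\<tau>\<in>configs \<Lambda>. spmf (sampled_config sampler I) \<tau> = marginal M \<Lambda> \<tau>) \<and>
      expected_time sampler I \<le> ennreal (443 * real \<Delta> * real (max 1 (card \<Lambda>)))"
    unfolding Let_def I_def[symmetric] m_def by blast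
qed

end
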